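(* For any stabilization parameter $\kappa>0$ and any time step size $\tau>0$, the sequence $(\mathbf Q_h^n,u_h^n,s_h^n)_{n\ge 0}$ generated by the GSAV-ETD2 scheme (predictor and corrector, defined in the context) satisfies the discrete energy dissipation law $$\mathcal E_h^{n+1}\le \mathcal E_h^{n},\qquad \forall\, n\ge 0,$$ where $\mathcal E_h^n=\mathcal E_h[\mathbf Q_h^n,u_h^n,s_h^n]$ and $$\mathcal E_h[\mathbf Q_h,u_h,s_h]=\frac K2\|\nabla_h\mathbf Q_h\|_h^2+B_0\|\Delta_h u_h\|_h^2+\frac\kappa2\big(\|\mathbf Q_h\|_h^2+\|u_h\|_h^2\big)+s_h .$$
   Context: **Parameters.** $d\in\{2,3\}$, $\Omega=[0,L_d]^d$ with periodic boundary conditions; $K>0$, $\alpha,a,b\in\mathbb R$, $\beta\ge0$, $\gamma>0$, $c>0$, $B_0>0$, $q>0$, $\kappa>0$. Either $d=3$, $\alpha<\beta^2/(27\gamma)$ and $s_+=\frac{\beta+\sqrt{\beta^2-24\alpha\gamma}}{4\gamma}$, or $d=2$, $\alpha<0$ and $s_+=\sqrt{-2\alpha/\gamma}$. (The decoupled case is $q=0$, in which all terms containing $q$ are absent.) $\zeta\in C^1(\mathbb R;(0,\infty))$ with $\zeta'\ge0$. $f_{\rm bn}(\mathbf Q)=\frac\alpha2\operatorname{tr}(\mathbf Q^2)-\frac\beta3\operatorname{tr}(\mathbf Q^3)+\frac\gamma4(\operatorname{tr}(\mathbf Q^2))^2$, $f_{\rm bs}(u)=\frac a2u^2+\frac b3u^3+\frac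 c4u^4$. **Grid.** $h=L_d/J$, $J$ a positive integer; $E_h^{\rm per}$ is the space of real periodic grid functions on the uniform grid of mesh size $h$ in $\Omega$ (period $J$ in each index). $D_k^\pm$ are forward/backward difference quotients in direction $k$, $D_k^c=\frac12(D_k^++D_k^-)$, $\nabla_hU=(D_k^+U)_{k}$, $\Delta_h=\sum_kD_k^+D_k^-$, $\Delta_h^2=\Delta_h\circ\Delta_h$, $D_h^2U=(D_i^cD_j^cU)_{i,j=1}^d$, and for matrix-valued grid functions $\operatorname{div}_{h,c}^2\boldsymbol\Phi=\sum_{i,j}D_i^cD_j^c\Phi^{ij}$. $\langle U,V\rangle_h=h^d\sum U V$ over one period, $\|U\|_h^2=\langle U,U\rangle_h$, $\|\nabla_hU\|_h^2=\sum_k\|D_k^+U\|_h^2$; for matrix-valued grid functions inner products and norms are sums over entries, and difference operators act entrywise. $\mathcal S_h^{(d)}$ is the space of symmetric traceless $d\times d$ matrix-valued grid functions. $|\cdot|_F$ is the Frobenius norm, $\mathbf A:\mathbf B=\sum A_{ij}B_{ij}$. **Operators.** $\mathcal L_h\mathbf Q_h=-K\Delta_h\mathbf Q_h+\kappa\mathbf Q_h$ on $\mathcal S_h^{(d)}$, $\mathcal D_hu_h=2B_0\Delta_h^2u_h+\kappa u_h$ on $E_h^{\rm per}$. With $\mathbf M_h=\frac{\mathbf Q_h}{s_+}+\frac{\mathbf I_d}{d}$, $$E_{1h}[\mathbf Q_h,u_h]=2B_0q^2\langle D_h^2u_h,\mathbf M_hu_h\rangle_h+B_0q^4\|\mathbf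 M_hu_h\|_h^2+\langle f_{\rm bn}(\mathbf Q_h),1\rangle_h+\langle f_{\rm bs}(u_h),1\rangle_h-\tfrac\kappa2(\|u_h\|_h^2+\|\mathbf Q_h\|_h^2),$$ $$\mathbf H_h=\kappa\mathbf Q_h-\alpha\mathbf Q_h+\beta\big(\mathbf Q_h^2-\tfrac{\operatorname{tr}(\mathbf Q_h^2)}d\mathbf I_d\big)-\gamma\operatorname{tr}(\mathbf Q_h^2)\mathbf Q_h-\tfrac{2B_0q^4}{s_+^2}\mathbf Q_hu_h^2-\tfrac{2B_0q^2}{s_+}\big(u_hD_h^2u_h-\tfrac{\operatorname{tr}(u_hD_h^2u_h)}d\mathbf I_d\big),$$ $$\mu_h=\kappa u_h-au_h-bu_h^2-cu_h^3-2B_0|q^2\mathbf M_h|_F^2u_h-2B_0q^2\big(\mathbf M_h:D_h^2u_h+\operatorname{div}_{h,c}^2(\mathbf M_hu_h)\big),$$ $g_h(\mathbf Q_h,u_h,s_h)=\zeta(s_h)/\zeta(E_{1h}[\mathbf Q_h,u_h])$, $\mathbf N_h=g_h\mathbf H_h$, $\mathcal N_h=g_h\mu_h$. **Scheme.** $\varphi_1(z)=\frac{1-e^{-z}}z$, $\varphi_2(z)=\frac{e^{-z}-1+z}{z^2}$ (extended continuously to $z=0$; functions of the self-adjoint operators $\tau\mathcal L_h,\tau\mathcal D_h$ are defined spectrally). The initial values are $\mathbf Q_h^0=\mathcal I_h\mathbf Q(0)$, $u_h^0=\mathcal I_hu(0)$ ($\mathcal I_h$ = restriction of given initial data, symmetric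 traceless for $\mathbf Q$, to the grid), $s_h^0=E_{1h}[\mathbf Q_h^0,u_h^0]$. Given $(\mathbf Q_h^n,u_h^n,s_h^n)$, let $\mathbf N_h^n,\mathcal N_h^n$ be $\mathbf N_h,\mathcal N_h$ evaluated there. Predictor: $$\mathbf Q_h^{n,*}=e^{-\tau\mathcal L_h}\mathbf Q_h^n+\tau\varphi_1(\tau\mathcal L_h)\mathbf N_h^n,\quad u_h^{n,*}=e^{-\tau\mathcal D_h}u_h^n+\tau\varphi_1(\tau\mathcal D_h)\mathcal N_h^n,$$ $$s_h^{n,*}=s_h^n-\langle\mathbf N_h^n,\mathbf Q_h^{n,*}-\mathbf Q_h^n\rangle_h-\langle\mathcal N_h^n,u_h^{n,*}-u_h^n\rangle_h.$$ With $\mathbf N_h^{n,*},\mathcal N_h^{n,*}$ the nonlinear terms at $(\mathbf Q_h^{n,*},u_h^{n,*},s_h^{n,*})$, corrector: $$\mathbf Q_h^{n+1}=e^{-\tau\mathcal L_h}\mathbf Q_h^n+\tau\varphi_1(\tau\mathcal L_h)\mathbf N_h^n+\tau\varphi_2(\tau\mathcal L_h)(\mathbf N_h^{n,*}-\mathbf N_h^n),$$ $$u_h^{n+1}=e^{-\tau\mathcal D_h}u_h^n+\tau\varphi_1(\tau\mathcal D_h)\mathcal N_h^n+\tau\varphi_2(\tau\mathcal D_h)(\mathcal N_h^{n,*}-\mathcal N_h^n),$$ $$s_h^{n+1}=s_h^n-\tfrac12\langle\mathbf N_h^n+\mathbf N_h^{n,*},\mathbf Q_h^{n+1}-\mathbf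 Q_h^n\rangle_h-\tfrac12\langle\mathcal N_h^n+\mathcal N_h^{n,*},u_h^{n+1}-u_h^n\rangle_h$$ $$\qquad-\tfrac14\langle\mathcal L_h(\mathbf Q_h^{n+1}-\mathbf Q_h^{n,*}),\mathbf Q_h^{n+1}-\mathbf Q_h^{n,*}\rangle_h-\tfrac14\langle\mathcal D_h(u_h^{n+1}-u_h^{n,*}),u_h^{n+1}-u_h^{n,*}\rangle_h.$$ *)

theory Defs
  imports "HOL-Analysis.Analysis"
begin

record gsav_params =
  p_L :: real      (* side length of the periodic box *)
  p_J :: nat       (* grid points per direction *)
  p_K :: real
  p_alpha :: real
  p_beta :: real
  p_gamma :: real
  p_a :: real
  p_b :: real
  p_c :: real
  p_B0 :: real
  p_q :: real
  p_kappa :: real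
  p_zeta :: "real \<Rightarrow> real"

definition mesh :: "gsav_params \<Rightarrow> real" where
  "mesh P = p_L P / real (p_J P)"

definition s_plus :: "nat \<Rightarrow> gsav_params \<Rightarrow> real" where
  "s_plus d P =
     (if d = 3
      then (p_beta P + sqrt ((p_beta P)^2 - 24 * p_alpha P * p_gamma P)) / (4 * p_gamma P)
      else sqrt (- 2 * p_alpha P / p_gamma P))"


section \<open>Periodic grid functions\<close>

text \<open>A grid function is indexed by all of \<open>\<int>\<^sup>d\<close>, \<open>d = CARD('d)\<close>; the index \<open>x\<close> stands for the point
  \<open>h x\<close>. Scalar (\<open>'a = real\<close>) and matrix-valued (\<open>'a = real^'d^'d\<close>) grid functions are treated
  uniformly: on matrices scaling, inner product and norm of HOL-Analysis are the entrywise scaling,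
  the Frobenius inner product \<open>A : B\<close> and the Frobenius norm.\<close>

type_synonym ('d, 'a) gridfun = "(int, 'd) vec \<Rightarrow> 'a"

definition grid_space :: "gsav_params \<Rightarrow> ('d::finite, 'a) gridfun set" where
  "grid_space P = {U. \<forall>x k. U (x + axis k (int (p_J P))) = U x}"

definition sym_traceless :: "(real^'d^'d::finite) set" where
  "sym_traceless = {A. transpose A = A \<and> trace A = 0}"

definition grid_space_S :: "gsav_params \<Rightarrow> ('d::finite, real^'d^'d) gridfun set" where
  "grid_space_S P = {Q \<in> grid_space P. \<forall>x. Q x \<in> sym_traceless}"

definition grid_restrict :: "gsav_params \<Rightarrow> (real^'d \<Rightarrow> 'a) \<Rightarrow> ('d::finite, 'a) gridfun" where
  "grid_restrict P F = (\<lambda>x. F (\<chi> k. mesh P * of_int (x $ k)))"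

definition D_fwd :: "gsav_params \<Rightarrow> 'd \<Rightarrow> ('d::finite, 'a::real_vector) gridfun \<Rightarrow> ('d, 'a) gridfun" where
  "D_fwd P k U = (\<lambda>x. (1 / mesh P) *\<^sub>R (U (x + axis k 1) - U x))"

definition D_bwd :: "gsav_params \<Rightarrow> 'd \<Rightarrow> ('d::finite, 'a::real_vector) gridfun \<Rightarrow> ('d, 'a) gridfun" where
  "D_bwd P k U = (\<lambda>x. (1 / mesh P) *\<^sub>R (U x - U (x - axis k 1)))"

definition D_cen :: "gsav_params \<Rightarrow> 'd \<Rightarrow> ('d::finite, 'a::real_vector) gridfun \<Rightarrow> ('d, 'a) gridfun" where
  "D_cen P k U = (\<lambda>x. (1 / 2) *\<^sub>R (D_fwd P k U x + D_bwd P k U x))"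

definition Lap :: "gsav_params \<Rightarrow> ('d::finite, 'a::real_vector) gridfun \<Rightarrow> ('d, 'a) gridfun" where
  "Lap P U = (\<lambda>x. \<Sum>k\<in>UNIV. D_fwd P k (D_bwd P k U) x)"

definition Hess :: "gsav_params \<Rightarrow> ('d::finite, real) gridfun \<Rightarrow> ('d, real^'d^'d) gridfun" where
  "Hess P u = (\<lambda>x. \<chi> i j. D_cen P i (D_cen P j u) x)"

definition div2 :: "gsav_params \<Rightarrow> ('d::finite, real^'d^'d) gridfun \<Rightarrow> ('d, real) gridfun" where
  "div2 P Phi = (\<lambda>x. \<Sum>i\<in>UNIV. \<Sum>j\<in>UNIV. D_cen P i (D_cen P j (\<lambda>y. Phi y $ i $ j)) x)"

definition cell :: "gsav_params \<Rightarrow> (int^'d::finite) set" where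
  "cell P = {x. \<forall>k. 0 \<le> x $ k \<and> x $ k < int (p_J P)}"

definition grid_inner ::
  "gsav_params \<Rightarrow> ('d::finite, 'a::real_inner) gridfun \<Rightarrow> ('d, 'a) gridfun \<Rightarrow> real" where
  "grid_inner P U V = mesh P ^ CARD('d) * (\<Sum>x\<in>cell P. U x \<bullet> V x)"

definition grid_norm :: "gsav_params \<Rightarrow> ('d::finite, 'a::real_inner) gridfun \<Rightarrow> real" where
  "grid_norm P U = sqrt (grid_inner P U U)"

definition grad_norm :: "gsav_params \<Rightarrow> ('d::finite, 'a::real_inner) gridfun \<Rightarrow> real" where
  "grad_norm P U = sqrt (\<Sum>k\<in>UNIV. (grid_norm P (D_fwd P k U))^2)"


section \<open>Functions of self-adjoint operators\<close>

definition eigenspace ::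
  "('d::finite, 'a::real_vector) gridfun set \<Rightarrow> (('d, 'a) gridfun \<Rightarrow> ('d, 'a) gridfun) \<Rightarrow> real
     \<Rightarrow> ('d, 'a) gridfun set" where
  "eigenspace V A l = {v \<in> V. A v = (\<lambda>x. l *\<^sub>R v x)}"

definition eigenvalues ::
  "('d::finite, 'a::real_vector) gridfun set \<Rightarrow> (('d, 'a) gridfun \<Rightarrow> ('d, 'a) gridfun) \<Rightarrow> real set" where
  "eigenvalues V A = {l. \<exists>v\<in>eigenspace V A l. v \<noteq> (\<lambda>x. 0)}"

definition orth_proj ::
  "gsav_params \<Rightarrow> ('d::finite, 'a::real_inner) gridfun set \<Rightarrow> ('d, 'a) gridfun \<Rightarrow> ('d, 'a) gridfun" where
  "orth_proj P E v = (THE p. p \<in> E \<and> (\<forall>e\<in>E. grid_inner P (\<lambda>x. v x - p x) e = 0))"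

text \<open>\<open>f(A) = \<Sum>\<^sub>\<lambda> f(\<lambda>) \<Pi>\<^sub>\<lambda>\<close>, where \<open>\<lambda>\<close> ranges over the eigenvalues of \<open>A\<close> on the space \<open>V\<close> and
  \<open>\<Pi>\<^sub>\<lambda>\<close> is the orthogonal projection onto the eigenspace. The space \<open>V\<close> matters, as it consists
  of periodic functions only.\<close>

definition op_fun ::
  "gsav_params \<Rightarrow> ('d::finite, 'a::real_inner) gridfun set \<Rightarrow> (real \<Rightarrow> real)
     \<Rightarrow> (('d, 'a) gridfun \<Rightarrow> ('d, 'a) gridfun) \<Rightarrow> ('d, 'a) gridfun \<Rightarrow> ('d, 'a) gridfun" where
  "op_fun P V f A v =
     (\<lambda>x. \<Sum>l\<in>eigenvalues V A. f l *\<^sub>R orth_proj P (eigenspace V A l) v x)"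

definition phi1 :: "real \<Rightarrow> real" where
  "phi1 z = (if z = 0 then 1 else (1 - exp (- z)) / z)"

definition phi2 :: "real \<Rightarrow> real" where
  "phi2 z = (if z = 0 then 1 / 2 else (exp (- z) - 1 + z) / z^2)"


section \<open>Operators and nonlinear terms\<close>

definition L_op :: "gsav_params \<Rightarrow> ('d::finite, real^'d^'d) gridfun \<Rightarrow> ('d, real^'d^'d) gridfun" where
  "L_op P Q = (\<lambda>x. - p_K P *\<^sub>R Lap P Q x + p_kappa P *\<^sub>R Q x)"

definition D_op :: "gsav_params \<Rightarrow> ('d::finite, real) gridfun \<Rightarrow> ('d, real) gridfun" where
  "D_op P u = (\<lambda>x. 2 * p_B0 P * Lap P (Lap P u) x + p_kappa P * u x)"

definition f_bn :: "gsav_params \<Rightarrow> real^'d^'d::finite \<Rightarrow> real" where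
  "f_bn P Q = p_alpha P / 2 * trace (Q ** Q) - p_beta P / 3 * trace (Q ** Q ** Q)
     + p_gamma P / 4 * (trace (Q ** Q))^2"

definition f_bs :: "gsav_params \<Rightarrow> real \<Rightarrow> real" where
  "f_bs P v = p_a P / 2 * v^2 + p_b P / 3 * v^3 + p_c P / 4 * v^4"

definition M_fun :: "gsav_params \<Rightarrow> ('d::finite, real^'d^'d) gridfun \<Rightarrow> ('d, real^'d^'d) gridfun" where
  "M_fun P Q = (\<lambda>x. (1 / s_plus CARD('d) P) *\<^sub>R Q x + (1 / real CARD('d)) *\<^sub>R mat 1)"

definition E1 :: "gsav_params \<Rightarrow> ('d::finite, real^'d^'d) gridfun \<Rightarrow> ('d, real) gridfun \<Rightarrow> real" where
  "E1 P Q u =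
     2 * p_B0 P * (p_q P)^2 * grid_inner P (Hess P u) (\<lambda>x. u x *\<^sub>R M_fun P Q x)
     + p_B0 P * (p_q P)^4 * (grid_norm P (\<lambda>x. u x *\<^sub>R M_fun P Q x))^2
     + grid_inner P (\<lambda>x. f_bn P (Q x)) (\<lambda>x. 1)
     + grid_inner P (\<lambda>x. f_bs P (u x)) (\<lambda>x. 1)
     - p_kappa P / 2 * ((grid_norm P u)^2 + (grid_norm P Q)^2)"

definition traceless_part :: "real^'d^'d::finite \<Rightarrow> real^'d^'d" where
  "traceless_part A = A - (trace A / real CARD('d)) *\<^sub>R mat 1"

definition H_term ::
  "gsav_params \<Rightarrow> ('d::finite, real^'d^'d) gridfun \<Rightarrow> ('d, real) gridfun \<Rightarrow> ('d, real^'d^'d) gridfun" where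
  "H_term P Q u = (\<lambda>x.
     p_kappa P *\<^sub>R Q x - p_alpha P *\<^sub>R Q x
     + p_beta P *\<^sub>R traceless_part (Q x ** Q x)
     - (p_gamma P * trace (Q x ** Q x)) *\<^sub>R Q x
     - (2 * p_B0 P * (p_q P)^4 / (s_plus CARD('d) P)^2 * (u x)^2) *\<^sub>R Q x
     - (2 * p_B0 P * (p_q P)^2 / s_plus CARD('d) P) *\<^sub>R traceless_part (u x *\<^sub>R Hess P u x))"

definition mu_term ::
  "gsav_params \<Rightarrow> ('d::finite, real^'d^'d) gridfun \<Rightarrow> ('d, real) gridfun \<Rightarrow> ('d, real) gridfun" where
  "mu_term P Q u = (\<lambda>x.
     p_kappa P * u x - p_a P * u x - p_b P * (u x)^2 - p_c P * (u x)^3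
     - 2 * p_B0 P * (norm ((p_q P)^2 *\<^sub>R M_fun P Q x))^2 * u x
     - 2 * p_B0 P * (p_q P)^2 *
         (M_fun P Q x \<bullet> Hess P u x + div2 P (\<lambda>y. u y *\<^sub>R M_fun P Q y) x))"

type_synonym 'd state =
  "('d, ((real, 'd) vec, 'd) vec) gridfun \<times> ('d, real) gridfun \<times> real"

definition g_fac :: "gsav_params \<Rightarrow> 'd::finite state \<Rightarrow> real" where
  "g_fac P X = (case X of (Q, u, s) \<Rightarrow> p_zeta P s / p_zeta P (E1 P Q u))"

definition N_Q :: "gsav_params \<Rightarrow> 'd::finite state \<Rightarrow> ('d, real^'d^'d) gridfun" where
  "N_Q P X = (case X of (Q, u, s) \<Rightarrow> (\<lambda>x. g_fac P X *\<^sub>R H_term P Q u x))"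

definition N_u :: "gsav_params \<Rightarrow> 'd::finite state \<Rightarrow> ('d, real) gridfun" where
  "N_u P X = (case X of (Q, u, s) \<Rightarrow> (\<lambda>x. g_fac P X * mu_term P Q u x))"


section \<open>The GSAV-ETD2 scheme and its energy\<close>

text \<open>\<open>f(\<tau> \<L>\<^sub>h)\<close> on the symmetric traceless grid functions and \<open>f(\<tau> \<D>\<^sub>h)\<close> on the scalar ones.\<close>

definition fun_L :: "gsav_params \<Rightarrow> real \<Rightarrow> (real \<Rightarrow> real)
    \<Rightarrow> ('d::finite, real^'d^'d) gridfun \<Rightarrow> ('d, real^'d^'d) gridfun" where
  "fun_L P tau f = op_fun P (grid_space_S P) f (\<lambda>Q x. tau *\<^sub>R L_op P Q x)"

definition fun_D :: "gsav_params \<Rightarrow> real \<Rightarrow> (real \<Rightarrow> real)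
    \<Rightarrow> ('d::finite, real) gridfun \<Rightarrow> ('d, real) gridfun" where
  "fun_D P tau f = op_fun P (grid_space P) f (\<lambda>u x. tau * D_op P u x)"

definition predictor :: "gsav_params \<Rightarrow> real \<Rightarrow> 'd::finite state \<Rightarrow> 'd state" where
  "predictor P tau X = (case X of (Q, u, s) \<Rightarrow>
     let NQ = N_Q P X; Nu = N_u P X;
         Q' = (\<lambda>x. fun_L P tau (\<lambda>z. exp (- z)) Q x + tau *\<^sub>R fun_L P tau phi1 NQ x);
         u' = (\<lambda>x. fun_D P tau (\<lambda>z. exp (- z)) u x + tau * fun_D P tau phi1 Nu x);
         s' = s - grid_inner P NQ (\<lambda>x. Q' x - Q x) - grid_inner P Nu (\<lambda>x. u' x - u x)
     in (Q', u', s'))"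

definition gsav_etd2_step :: "gsav_params \<Rightarrow> real \<Rightarrow> 'd::finite state \<Rightarrow> 'd state" where
  "gsav_etd2_step P tau X = (case (X, predictor P tau X) of ((Q, u, s), (Qp, up, sp)) \<Rightarrow>
     let NQ = N_Q P X; Nu = N_u P X;
         NQp = N_Q P (Qp, up, sp); Nup = N_u P (Qp, up, sp);
         Q' = (\<lambda>x. fun_L P tau (\<lambda>z. exp (- z)) Q x + tau *\<^sub>R fun_L P tau phi1 NQ x
                 + tau *\<^sub>R fun_L P tau phi2 (\<lambda>y. NQp y - NQ y) x);
         u' = (\<lambda>x. fun_D P tau (\<lambda>z. exp (- z)) u x + tau * fun_D P tau phi1 Nu x
                 + tau * fun_D P tau phi2 (\<lambda>y. Nup y - Nu y) x);
         dQ = (\<lambda>x. Q' x - Qp x);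
         du = (\<lambda>x. u' x - up x);
         s' = s - 1/2 * grid_inner P (\<lambda>x. NQ x + NQp x) (\<lambda>x. Q' x - Q x)
                - 1/2 * grid_inner P (\<lambda>x. Nu x + Nup x) (\<lambda>x. u' x - u x)
                - 1/4 * grid_inner P (L_op P dQ) dQ
                - 1/4 * grid_inner P (D_op P du) du
     in (Q', u', s'))"

primrec gsav_etd2 ::
  "gsav_params \<Rightarrow> real \<Rightarrow> (real^'d \<Rightarrow> real^'d^'d) \<Rightarrow> (real^'d \<Rightarrow> real) \<Rightarrow> nat \<Rightarrow> 'd::finite state" where
  "gsav_etd2 P tau Q0 u0 0 =
     (grid_restrict P Q0, grid_restrict P u0, E1 P (grid_restrict P Q0) (grid_restrict P u0))"
| "gsav_etd2 P tau Q0 u0 (Suc n) = gsav_etd2_step P tau (gsav_etd2 P tau Q0 u0 n)"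

definition energy :: "gsav_params \<Rightarrow> 'd::finite state \<Rightarrow> real" where
  "energy P X = (case X of (Q, u, s) \<Rightarrow>
     p_K P / 2 * (grad_norm P Q)^2 + p_B0 P * (grid_norm P (Lap P u))^2
     + p_kappa P / 2 * ((grid_norm P Q)^2 + (grid_norm P u)^2) + s)"

end

theory Submission
  imports Defs "HOL-Library.Real_Mod"
begin

text \<open>Summation by parts turns the quadratic part of the energy into
  \<open>\<langle>\<L> Q, Q\<rangle>/2 + \<langle>\<D> u, u\<rangle>/2\<close>, so that inserting the update of \<open>s\<close> splits the energy change into one
  quadratic expression for \<open>\<L>\<close> and one for \<open>\<D>\<close>. Both operators are diagonalized by the discrete
  Fourier modes, which reduces each expression to a scalar one on every eigenspace. For an
  eigenvalue \<open>a > 0\<close> of \<open>\<tau>\<L>\<close>, with \<open>d = v' - v\<close> and \<open>y = \<tau>(N\<^sup>* - N)\<close>, it is \<open>1/\<tau>\<close> times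
  \<open>- (1/\<phi>\<^sub>1 - a/2) |d|\<^sup>2 + (\<phi>\<^sub>2/\<phi>\<^sub>1 - 1/2) y\<cdot>d - (a \<phi>\<^sub>2\<^sup>2/4) |y|\<^sup>2\<close>,
  a quadratic form with nonpositive discriminant, hence negative semidefinite.
  The size of the nonlinearities plays no role.\<close>

section \<open>The scalar quadratic form\<close>

text \<open>The (1,1) Pade bound for the exponential, equivalent to tanh (a/2) <= a/2. The
  difference of the two sides vanishes at 0 and has derivative
  \<open>1 - (1 + t) * exp (- t)\<close>, which is nonnegative because
  \<open>1 + t \<le> exp t\<close>.\<close>

lemma exp_minus_ge_pade:
  fixes a :: real
  assumes "a \<ge> 0"
  shows "2 - a \<le> (2 + a) * exp (- a)"
proof -
  let ?g = "\<lambda>t::real. (2 + t) * exp (- t) - 2 + t"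
  have "?g 0 \<le> ?g a"
  proof (rule DERIV_nonneg_imp_nondecreasing[OF assms])
    fix t :: real assume "0 \<le> t" "t \<le> a"
    have "(?g has_real_derivative (1 - (1 + t) * exp (- t))) (at t)"
      by (auto intro!: derivative_eq_intros simp: algebra_simps)
    moreover have "(1 + t) * exp (- t) \<le> 1"
      using exp_ge_add_one_self[of t] by (simp add: exp_minus field_simps)
    ultimately show "\<exists>y. (?g has_real_derivative y) (at t) \<and> 0 \<le> y" by fastforce
  qed
  then show ?thesis by simp
qed

text \<open>With \<open>c = coth (a/2)\<close> and \<open>X = a c - 2\<close> the discriminant condition reads
  \<open>X\<^sup>2 (1 + c)\<^sup>2 \<le> 2 c (a + X)\<^sup>2\<close>. It follows from \<open>0 \<le> X \<le> min a (a\<^sup>2/2)\<close>.\<close>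

lemma etd2_discriminant:
  fixes a :: real
  assumes a: "a > 0"
  shows "0 < 1 / phi1 a - a / 2"
    and "(phi2 a / phi1 a - 1 / 2)\<^sup>2 \<le> 4 * (1 / phi1 a - a / 2) * (a * (phi2 a)\<^sup>2 / 4)"
proof -
  define e where "e = exp (- a)"
  have e: "0 < e" "e < 1" using a by (auto simp: e_def)
  define c where "c = (1 + e) / (1 - e)"
  define X where "X = a * c - 2"
  have c1: "c > 1" using e by (simp add: c_def field_simps)
  have ce: "c * (1 - e) = 1 + e" using e by (simp add: c_def)
  have Xe: "X * (1 - e) = a * (1 + e) - 2 * (1 - e)"
    by (simp add: X_def left_diff_distrib ce mult.assoc)
  \<comment> \<open>The denominator of \<open>c\<close> is \<open>1 - e > 0\<close>, so every bound
    on \<open>X\<close> below is shown after multiplication by it, which leaves an inequality in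
    \<open>a\<close> and \<open>e\<close>.\<close>
  have ge_zeroI: "0 \<le> t" if "0 \<le> t * (1 - e)" for t
    using that e by (simp add: zero_le_mult_iff)
  have X0: "X \<ge> 0"
  proof (rule ge_zeroI)
    show "0 \<le> X * (1 - e)"
      using exp_minus_ge_pade[of a] a unfolding Xe by (simp add: e_def algebra_simps)
  qed
  have Ee: "exp a * e = 1" by (simp add: e_def flip: exp_add)
  \<comment> \<open>After multiplication by \<open>1 - e\<close>, the bound \<open>X \<le> a\<close>
    becomes \<open>(1 + a) * e \<le> 1\<close>.\<close>
  have "(1 + a) * e \<le> exp a * e"
    using exp_ge_add_one_self[of a] e by (intro mult_right_mono) auto
  then have "0 \<le> (a - X) * (1 - e)"
    unfolding left_diff_distrib[of a X] Xe Ee by (simp add: algebra_simps)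
  then have Xa: "X \<le> a" using ge_zeroI[of "a - X"] by simp
  \<comment> \<open>\<open>(a^2/2 - X) * (1 - e)\<close> equals
    \<open>w - (2 + a + a^2/2) * e\<close>. It is nonnegative because the quadratic Taylor
    polynomial of \<open>exp a\<close> times \<open>w\<close> exceeds \<open>2 + a + a^2/2\<close>
    by exactly \<open>a^4/4\<close>.\<close>
  define w where "w = 2 - a + a\<^sup>2 / 2"
  have w: "w \<ge> 0"
    using zero_le_power2[of "a - 1"] unfolding w_def power2_eq_square by (simp add: algebra_simps)
  have "1 + a + a\<^sup>2 / 2 \<le> exp a" using exp_lower_Taylor_quadratic[of a] a by simp
  then have "(1 + a + a\<^sup>2 / 2) * w \<le> exp a * w" using w by (rule mult_right_mono)
  moreover have "(1 + a + a\<^sup>2 / 2) * w = 2 + a + a\<^sup>2 / 2 + a^4 / 4"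
    unfolding w_def by (simp add: power2_eq_square power4_eq_xxxx algebra_simps)
  moreover have "a^4 / 4 \<ge> 0" by simp
  ultimately have "2 + a + a\<^sup>2 / 2 \<le> exp a * w" by linarith
  then have "(2 + a + a\<^sup>2 / 2) * e \<le> exp a * w * e" using e by (intro mult_right_mono) auto
  also have "\<dots> = w" using Ee by (simp add: mult.commute mult.left_commute)
  finally have "0 \<le> (a\<^sup>2 / 2 - X) * (1 - e)"
    unfolding left_diff_distrib[of _ X] Xe w_def by (simp add: algebra_simps diff_divide_distrib)
  then have X2: "2 * X \<le> a\<^sup>2" using ge_zeroI[of "a\<^sup>2 / 2 - X"] by simp
  \<comment> \<open>Split into \<open>X^2\<close>, bounded through \<open>X \<le> a\<close>, and
    \<open>2 * X \<le> a^2\<close>. Since \<open>X + 2 = a * c\<close>, this is a bound on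
    \<open>X * c\<close>.\<close>
  have "X * (X + 2) \<le> 2 * a\<^sup>2"
    using X2 Xa X0 a mult_mono[OF Xa Xa] by (simp add: power2_eq_square algebra_simps)
  then have "a * (X * c) \<le> a * (2 * a)" by (simp add: X_def power2_eq_square algebra_simps)
  then have Xc: "X * c \<le> 2 * a" using a by simp
  \<comment> \<open>Here \<open>c > 1\<close> gives \<open>1 + c \<le> 2 * c\<close>; the chain then
    ends with \<open>4 * a * X \<le> (a + X)^2\<close>.\<close>
  have "X * (1 + c)\<^sup>2 \<le> X * (2 * c)\<^sup>2"
    using X0 c1 by (intro mult_left_mono power_mono) auto
  also have "\<dots> = 4 * c * (X * c)" by (simp add: power2_eq_square)
  also have "\<dots> \<le> 4 * c * (2 * a)" using Xc c1 by (intro mult_left_mono) auto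
  finally have "X * (X * (1 + c)\<^sup>2) \<le> X * (4 * c * (2 * a))"
    using X0 mult_left_mono by blast
  also have "\<dots> = 2 * c * (4 * a * X)" by simp
  also have "\<dots> \<le> 2 * c * (a + X)\<^sup>2"
    using c1 sum_squares_ge_zero[of "a - X" 0]
    by (intro mult_left_mono) (auto simp: power2_eq_square algebra_simps)
  finally have main: "X\<^sup>2 * (1 + c)\<^sup>2 \<le> 2 * c * (a + X)\<^sup>2" by (simp add: power2_eq_square)
  have p: "phi1 a = (1 - e) / a" using a by (simp add: phi1_def e_def)
  have r: "phi2 a = (e - 1 + a) / a\<^sup>2" using a by (simp add: phi2_def e_def)
  have c_p: "1 + c = 2 / (1 - e)" using e by (simp add: c_def field_simps)
  have A: "1 / phi1 a - a / 2 = a * c / 2" using e a by (simp add: p c_def field_simps)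
  show "0 < 1 / phi1 a - a / 2" unfolding A using a c1 by simp
  have k: "phi2 a / phi1 a - 1 / 2 = X / (2 * a)"
    using e a by (simp add: p r X_def c_def field_simps power2_eq_square)
  have r': "phi2 a = (a + X) / (a\<^sup>2 * (1 + c))"
    using e a unfolding c_p by (simp add: r X_def c_def field_simps power2_eq_square)
  \<comment> \<open>With \<open>z = 1 + c\<close>, both sides of the discriminant condition are put
    over the common denominator \<open>4 * a^2 * z^2\<close>, so that only \<open>main\<close> is
    left to compare the numerators.\<close>
  have eq: "4 * (a * c / 2) * (a * (y / (a\<^sup>2 * z))\<^sup>2 / 4) = (2 * c * y\<^sup>2) / (4 * a\<^sup>2 * z\<^sup>2)"
    "(X / (2 * a))\<^sup>2 = (X\<^sup>2 * z\<^sup>2) / (4 * a\<^sup>2 * z\<^sup>2)" if "z \<noteq> 0" for y z :: real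
    using a that by (simp_all add: field_simps power2_eq_square)
  have z: "1 + c \<noteq> 0" using c1 by simp
  show "(phi2 a / phi1 a - 1 / 2)\<^sup>2 \<le> 4 * (1 / phi1 a - a / 2) * (a * (phi2 a)\<^sup>2 / 4)"
    unfolding k A unfolding r' eq(1)[OF z] eq(2)[OF z] by (intro divide_right_mono main) simp
qed

text \<open>The vectors \<open>n\<close> and \<open>y\<close> include the factor tau. Solving the
  update for \<open>n\<close> in terms of the increment \<open>d\<close>, of \<open>v\<close> and of
  \<open>y\<close> makes all terms containing \<open>v\<close> cancel; a quadratic form in
  \<open>d\<close> and \<open>y\<close> remains.\<close>

lemma etd2_pointwise:
  fixes v n y :: "'a::real_inner" and a :: real
  assumes a: "a > 0"
    and v': "v' = exp (- a) *\<^sub>R v + phi1 a *\<^sub>R n + phi2 a *\<^sub>R y"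
  shows "a / 2 * (v' \<bullet> v') - a / 2 * (v \<bullet> v) - 1/2 * ((2 *\<^sub>R n + y) \<bullet> (v' - v))
     - a / 4 * ((phi2 a *\<^sub>R y) \<bullet> (phi2 a *\<^sub>R y)) \<le> 0"
proof -
  define A where "A = 1 / phi1 a - a / 2"
  define k where "k = phi2 a / phi1 a - 1 / 2"
  define C where "C = a * (phi2 a)\<^sup>2 / 4"
  have A: "A > 0" and kAC: "k\<^sup>2 \<le> 4 * A * C"
    using etd2_discriminant[OF a] by (auto simp: A_def k_def C_def)
  have p: "phi1 a \<noteq> 0" using a by (simp add: phi1_def)
  \<comment> \<open>In this form the update reads \<open>d = phi1 a *\<^sub>R (n - a *\<^sub>R v) +
    phi2 a *\<^sub>R y\<close>, which can be solved for \<open>n\<close>.\<close>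
  have e: "exp (- a) = 1 - a * phi1 a" using a by (simp add: phi1_def)
  define d where "d = v' - v"
  have "phi1 a *\<^sub>R n = d + (a * phi1 a) *\<^sub>R v - phi2 a *\<^sub>R y"
    by (simp add: d_def v' e algebra_simps)
  then have "(1 / phi1 a) *\<^sub>R (phi1 a *\<^sub>R n) = (1 / phi1 a) *\<^sub>R (d + (a * phi1 a) *\<^sub>R v - phi2 a *\<^sub>R y)"
    by simp
  then have n: "n = (1 / phi1 a) *\<^sub>R d + a *\<^sub>R v - (phi2 a / phi1 a) *\<^sub>R y"
    using p by (simp add: scaleR_add_right scaleR_diff_right)
  have v'd: "v' = v + d" by (simp add: d_def)
  have "a / 2 * (v' \<bullet> v') - a / 2 * (v \<bullet> v) - 1/2 * ((2 *\<^sub>R n + y) \<bullet> (v' - v))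
     - a / 4 * ((phi2 a *\<^sub>R y) \<bullet> (phi2 a *\<^sub>R y))
     = - A * (d \<bullet> d) + k * (y \<bullet> d) - C * (y \<bullet> y)"
    unfolding v'd n A_def k_def C_def
    by (simp add: inner_add_left inner_add_right inner_diff_left inner_diff_right
        inner_commute power2_eq_square algebra_simps)
  \<comment> \<open>Completing the square in \<open>d\<close>.\<close>
  also have "\<dots> = ((k\<^sup>2 - 4 * A * C) * (y \<bullet> y) - ((2 * A) *\<^sub>R d - k *\<^sub>R y) \<bullet> ((2 * A) *\<^sub>R d - k *\<^sub>R y)) / (4 * A)"
    using A by (simp add: inner_diff_left inner_diff_right inner_commute power2_eq_square field_simps)
  also have "\<dots> \<le> 0"
    using A kAC by (intro divide_nonpos_pos) (auto simp: mult_nonpos_nonneg intro: order_trans[of _ 0])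
  finally show ?thesis .
qed

section \<open>Periodic grid functions\<close>

lemma finite_cell [simp]: "finite (cell P :: (int^'d::finite) set)"
proof -
  have "cell P \<subseteq> vec_lambda ` (PiE (UNIV::'d set) (\<lambda>_. {0..<int (p_J P)}))"
  proof
    fix x :: "int^'d" assume "x \<in> cell P"
    then show "x \<in> vec_lambda ` (PiE (UNIV::'d set) (\<lambda>_. {0..<int (p_J P)}))"
      by (intro image_eqI[of _ _ "vec_nth x"]) (auto simp: cell_def)
  qed
  then show ?thesis by (rule finite_subset) (auto intro!: finite_PiE)
qed

lemma grid_spaceD: "U \<in> grid_space P \<Longrightarrow> U (x + axis k (int (p_J P))) = U x"
  by (simp add: grid_space_def)

lemma grid_space_comp: "U \<in> grid_space P \<Longrightarrow> (\<lambda>x. F (U x)) \<in> grid_space P"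
  by (simp add: grid_space_def)

lemma grid_space_comp2:
  "U \<in> grid_space P \<Longrightarrow> V \<in> grid_space P \<Longrightarrow> (\<lambda>x. F (U x) (V x)) \<in> grid_space P"
  by (simp add: grid_space_def)

lemma grid_space_translate:
  assumes "U \<in> grid_space P" shows "(\<lambda>x. U (x + z)) \<in> grid_space P"
  unfolding grid_space_def
proof (intro CollectI allI)
  fix x k
  show "U (x + axis k (int (p_J P)) + z) = U (x + z)"
    using grid_spaceD[OF assms, of "x + z" k] by (simp add: algebra_simps)
qed

text \<open>The shifted cell loses one boundary layer and gains the opposite one; periodicity
  identifies the two.\<close>

lemma sum_cell_shift:
  fixes f :: "('d::finite, 'a::comm_monoid_add) gridfun"
  assumes f: "f \<in> grid_space P" and J: "p_J P > 0"
  shows "(\<Sum>x\<in>cell P. f (x + axis k 1)) = (\<Sum>x\<in>cell P. f x)"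
proof -
  let ?J = "int (p_J P)"
  \<comment> \<open>The shift with wraparound: the last layer, with index \<open>?J - 1\<close>,
    goes to index 0. The map \<open>?i\<close> is its inverse.\<close>
  let ?j = "\<lambda>x::int^'d. if x $ k = ?J - 1 then x - axis k (?J - 1) else x + axis k 1"
  let ?i = "\<lambda>x::int^'d. if x $ k = 0 then x + axis k (?J - 1) else x - axis k 1"
  have fj: "f (?j x) = f (x + axis k 1)" for x
  proof (cases "x $ k = ?J - 1")
    case True
    have "x + axis k 1 = (x - axis k (?J - 1)) + axis k ?J"
      by (simp add: vec_eq_iff axis_def)
    then show ?thesis using True grid_spaceD[OF f, of "x - axis k (?J - 1)" k] by metis
  qed simp
  have J': "?J > 0" using J by simp
  show ?thesis
  proof (rule sum.reindex_bij_witness[where j = ?j and i = ?i])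
    fix x :: "int^'d" assume x: "x \<in> cell P"
    have xk: "0 \<le> x $ k" "x $ k < ?J" using x by (auto simp: cell_def)
    show "?i (?j x) = x" using xk by (auto simp: vec_eq_iff axis_def)
    show "?j (?i x) = x" using xk by (auto simp: vec_eq_iff axis_def)
    have "0 \<le> ?j x $ i \<and> ?j x $ i < ?J" for i
    proof (cases "i = k")
      case True
      then show ?thesis using xk by (auto simp: axis_def)
    next
      case False
      then show ?thesis using x by (auto simp: cell_def axis_def)
    qed
    then show "?j x \<in> cell P" by (simp add: cell_def)
    have "0 \<le> ?i x $ i \<and> ?i x $ i < ?J" for i
    proof (cases "i = k")
      case True
      then show ?thesis using xk J' by (auto simp: axis_def)
    next
      case False
      then show ?thesis using x by (auto simp: cell_def axis_def)
    qed
    then show "?i x \<in> cell P" by (simp add: cell_def)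
    show "f (?j x) = f (x + axis k 1)" by (rule fj)
  qed
qed

lemma grid_space_axis_multiple:
  assumes "U \<in> grid_space P"
  shows "U (x + axis k (int (p_J P) * m)) = U x"
proof (induction m rule: int_induct[where k = 0])
  case base
  have "axis k (0::int) = 0" by (simp add: vec_eq_iff axis_def)
  then show ?case by (metis add_0_right mult_zero_right)
next
  case (step1 i)
  have "x + axis k (int (p_J P) * (i + 1)) = (x + axis k (int (p_J P) * i)) + axis k (int (p_J P))"
    by (simp add: vec_eq_iff axis_def algebra_simps)
  then show ?case using step1 grid_spaceD[OF assms] by metis
next
  case (step2 i)
  have "x + axis k (int (p_J P) * i) = (x + axis k (int (p_J P) * (i - 1))) + axis k (int (p_J P))"
    by (simp add: vec_eq_iff axis_def algebra_simps)
  then show ?case using step2 grid_spaceD[OF assms] by metis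
qed

lemma grid_space_mod:
  fixes U :: "('d::finite, 'a) gridfun"
  assumes U: "U \<in> grid_space P"
  shows "U (\<chi> k. x $ k mod int (p_J P)) = U x"
proof -
  let ?J = "int (p_J P)"
  \<comment> \<open>The coordinates are reduced one at a time; \<open>S\<close> is the set of those
    already reduced.\<close>
  have "U (\<chi> k. if k \<in> S then x $ k mod ?J else x $ k) = U x" if "finite S" for S
    using that
  proof induction
    case empty
    then show ?case by (simp add: vec_nth_inverse)
  next
    case (insert k S)
    let ?w = "\<lambda>S. (\<chi> k. if k \<in> S then x $ k mod ?J else x $ k) :: int^'d"
    have "?w S = ?w (insert k S) + axis k (?J * (x $ k div ?J))"
      using insert(2) by (auto simp: vec_eq_iff axis_def)
    then have "U (?w S) = U (?w (insert k S))"
      using grid_space_axis_multiple[OF U, of "?w (insert k S)" k] by simp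
    then show ?case using insert(3) by simp
  qed
  from this[of UNIV] show ?thesis by simp
qed

text \<open>Reduction modulo the period moves every index into the cell. This carries identities
  checked on the cell over to the whole lattice.\<close>

lemma grid_space_eqI:
  fixes U V :: "('d::finite, 'a) gridfun"
  assumes "U \<in> grid_space P" "V \<in> grid_space P" "p_J P > 0"
    and eq: "\<And>x. x \<in> cell P \<Longrightarrow> U x = V x"
  shows "U = V"
proof
  fix x :: "int^'d"
  let ?y = "(\<chi> k. x $ k mod int (p_J P)) :: int^'d"
  have "?y \<in> cell P" using assms(3) by (simp add: cell_def)
  then show "U x = V x"
    using eq[of ?y] grid_space_mod[OF assms(1), of x] grid_space_mod[OF assms(2), of x] by simp
qed

lemma mesh_pos: "p_L P > 0 \<Longrightarrow> p_J P > 0 \<Longrightarrow> mesh P > 0"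
  by (simp add: mesh_def)

lemma grid_inner_commute: "grid_inner P U V = grid_inner P V U"
  by (simp add: grid_inner_def inner_commute)

lemma grid_inner_add_left:
  "grid_inner P (\<lambda>x. U x + W x) V = grid_inner P U V + grid_inner P W V"
  by (simp add: grid_inner_def inner_add_left sum.distrib distrib_left)

lemma grid_inner_diff_left:
  "grid_inner P (\<lambda>x. U x - W x) V = grid_inner P U V - grid_inner P W V"
  by (simp add: grid_inner_def inner_diff_left sum_subtractf right_diff_distrib)

lemma grid_inner_scaleR_left:
  "grid_inner P (\<lambda>x. c *\<^sub>R U x) V = c * grid_inner P U V"
  by (simp add: grid_inner_def sum_distrib_left mult.left_commute)

lemma grid_inner_sum_left:
  "grid_inner P (\<lambda>x. \<Sum>a\<in>S. f a x) V = (\<Sum>a\<in>S. grid_inner P (f a) V)"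
  unfolding grid_inner_def inner_sum_left
  by (subst sum.swap) (simp add: sum_distrib_left)

lemma grid_inner_sum_right:
  "grid_inner P V (\<lambda>x. \<Sum>a\<in>S. f a x) = (\<Sum>a\<in>S. grid_inner P V (f a))"
  by (subst (1 2) grid_inner_commute) (rule grid_inner_sum_left)

lemma grid_inner_nonneg: "mesh P > 0 \<Longrightarrow> 0 \<le> grid_inner P U U"
  by (simp add: grid_inner_def sum_nonneg)

lemma grid_norm_sq: "mesh P > 0 \<Longrightarrow> (grid_norm P U)\<^sup>2 = grid_inner P U U"
  by (simp add: grid_norm_def grid_inner_nonneg)

text \<open>The form sees only values on the cell, so definiteness comes from periodicity.\<close>

lemma grid_inner_self_eq_0D:
  fixes U :: "('d::finite, 'a::real_inner) gridfun"
  assumes "U \<in> grid_space P" "p_L P > 0" "p_J P > 0" "grid_inner P U U = 0"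
  shows "U = (\<lambda>x. 0)"
proof (rule grid_space_eqI[OF assms(1)])
  have "(\<Sum>x\<in>cell P. U x \<bullet> U x) = 0"
    using assms(4) mesh_pos[OF assms(2,3)] by (simp add: grid_inner_def)
  then show "U x = 0" if "x \<in> cell P" for x
    using that by (subst (asm) sum_nonneg_eq_0_iff) auto
qed (use assms in \<open>auto simp: grid_space_def\<close>)

section \<open>Difference operators and summation by parts\<close>

lemma Lap_eq:
  fixes U :: "('d::finite, 'a::real_vector) gridfun"
  shows
  "Lap P U x = (1 / (mesh P)\<^sup>2) *\<^sub>R (\<Sum>k\<in>UNIV. U (x + axis k 1) + U (x - axis k 1) - 2 *\<^sub>R U x)"
  unfolding Lap_def D_fwd_def D_bwd_def scaleR_sum_right
proof (intro sum.cong refl)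
  fix k :: 'd
  have "(U (x + axis k 1) - U x) - (U x - U (x - axis k 1)) = U (x + axis k 1) + U (x - axis k 1) - 2 *\<^sub>R U x"
    by (simp add: scaleR_2)
  then show "(1 / mesh P) *\<^sub>R ((1 / mesh P) *\<^sub>R (U (x + axis k 1) - U (x + axis k 1 - axis k 1))
      - (1 / mesh P) *\<^sub>R (U x - U (x - axis k 1)))
    = (1 / (mesh P)\<^sup>2) *\<^sub>R (U (x + axis k 1) + U (x - axis k 1) - 2 *\<^sub>R U x)"
    by (simp add: power2_eq_square flip: scaleR_diff_right)
qed

lemma grid_space_shifts:
  assumes "U \<in> grid_space P"
  shows "U (x + axis k (int (p_J P)) + z) = U (x + z)"
    and "U (x + axis k (int (p_J P)) - z) = U (x - z)"
proof -
  have "x + axis k (int (p_J P)) + z = x + z + axis k (int (p_J P))"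
    "x + axis k (int (p_J P)) - z = x - z + axis k (int (p_J P))"
    by (simp_all add: algebra_simps)
  then show "U (x + axis k (int (p_J P)) + z) = U (x + z)"
    "U (x + axis k (int (p_J P)) - z) = U (x - z)"
    by (simp_all only: grid_spaceD[OF assms])
qed

lemma Lap_in_grid_space: "U \<in> grid_space P \<Longrightarrow> Lap P U \<in> grid_space P"
  using grid_space_shifts[of U P] grid_spaceD[of U P]
  unfolding grid_space_def[of P] Lap_eq[abs_def] by (simp only: mem_Collect_eq simp_thms)

lemma D_cen_eq: "D_cen P k U x = (1 / (2 * mesh P)) *\<^sub>R (U (x + axis k 1) - U (x - axis k 1))"
  by (simp add: D_cen_def D_fwd_def D_bwd_def flip: scaleR_add_right)

text \<open>Translations of the lattice commute. This makes the discrete Hessian symmetric.\<close>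

lemma D_cen_commute:
  fixes U :: "('d::finite, 'b::real_vector) gridfun"
  shows "D_cen P i (D_cen P j U) = D_cen P j (D_cen P i U)"
proof
  fix x
  have eq: "U (x + axis i 1 + axis j 1) = U (x + axis j 1 + axis i 1)"
    "U (x + axis i 1 - axis j 1) = U (x - axis j 1 + axis i 1)"
    "U (x - axis i 1 + axis j 1) = U (x + axis j 1 - axis i 1)"
    "U (x - axis i 1 - axis j 1) = U (x - axis j 1 - axis i 1)"
    by (simp_all only: add.assoc diff_conv_add_uminus add.commute[of "axis i 1"] add.commute[of "- axis i 1"])
  have "c *\<^sub>R (c *\<^sub>R (y1 - y2) - c *\<^sub>R (y3 - y4)) = c *\<^sub>R (c *\<^sub>R (y1 - y3) - c *\<^sub>R (y2 - y4))"
    for c and y1 y2 y3 y4 :: 'b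
    by (simp add: scaleR_diff_right)
  then show "D_cen P i (D_cen P j U) x = D_cen P j (D_cen P i U) x"
    unfolding D_cen_eq eq(1) eq(2) eq(3) eq(4) .
qed

lemma D_cen_in_grid_space: "U \<in> grid_space P \<Longrightarrow> D_cen P k U \<in> grid_space P"
  using grid_space_shifts[of U P] grid_spaceD[of U P]
  unfolding grid_space_def[of P] D_cen_eq[abs_def] by (simp only: mem_Collect_eq simp_thms)

text \<open>In each direction the second difference is a forward minus a backward difference; in the
  sum with the backward one, the index is shifted by one, which periodicity permits.\<close>

lemma grid_inner_Lap:
  fixes U V :: "('d::finite, 'a::real_inner) gridfun"
  assumes U: "U \<in> grid_space P" and V: "V \<in> grid_space P" and J: "p_J P > 0"
  shows "grid_inner P (Lap P U) V = - (\<Sum>k\<in>UNIV. grid_inner P (D_fwd P k U) (D_fwd P k V))"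
proof -
  have per: "(\<lambda>x. (U x - U (x - axis k 1)) \<bullet> V x) \<in> grid_space P" for k :: 'd
    using grid_space_translate[OF U, of "- axis k 1"] U V by (simp add: grid_space_def)
  have "(\<Sum>x\<in>cell P. (U (x + axis k 1) + U (x - axis k 1) - 2 *\<^sub>R U x) \<bullet> V x)
      = - (\<Sum>x\<in>cell P. (U (x + axis k 1) - U x) \<bullet> (V (x + axis k 1) - V x))" for k :: 'd
  proof -
    have "(\<Sum>x\<in>cell P. (U (x + axis k 1) - U x) \<bullet> V (x + axis k 1))
        = (\<Sum>x\<in>cell P. (U x - U (x - axis k 1)) \<bullet> V x)"
      using sum_cell_shift[OF per J, of k k] by simp
    moreover have "(U (x + axis k 1) + U (x - axis k 1) - 2 *\<^sub>R U x) \<bullet> V x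
        = (U (x + axis k 1) - U x) \<bullet> V x - (U x - U (x - axis k 1)) \<bullet> V x" for x
      by (simp add: scaleR_2 inner_diff_left inner_add_left)
    ultimately show ?thesis
      by (simp only: inner_diff_right sum_subtractf)
  qed
  then have *: "(\<Sum>k\<in>UNIV. \<Sum>x\<in>cell P. (U (x + axis k 1) + U (x - axis k 1) - 2 *\<^sub>R U x) \<bullet> V x)
      = - (\<Sum>k\<in>UNIV. \<Sum>x\<in>cell P. (U (x + axis k 1) - U x) \<bullet> (V (x + axis k 1) - V x))"
    by (simp add: sum_negf)
  have "(\<Sum>x\<in>cell P. Lap P U x \<bullet> V x) = (1 / (mesh P)\<^sup>2) *
      (\<Sum>k\<in>UNIV. \<Sum>x\<in>cell P. (U (x + axis k 1) + U (x - axis k 1) - 2 *\<^sub>R U x) \<bullet> V x)"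
    unfolding Lap_eq inner_scaleR_left inner_sum_left
    by (subst sum.swap) (simp add: sum_distrib_left)
  also have "\<dots> = - (\<Sum>k\<in>UNIV. \<Sum>x\<in>cell P. D_fwd P k U x \<bullet> D_fwd P k V x)"
    unfolding * by (simp add: D_fwd_def sum_distrib_left power2_eq_square)
  finally show ?thesis
    by (simp add: grid_inner_def sum_distrib_left flip: mult_minus_right)
qed

lemma Lap_selfadjoint:
  assumes "U \<in> grid_space P" "V \<in> grid_space P" "p_J P > 0"
  shows "grid_inner P (Lap P U) V = grid_inner P U (Lap P V)"
  using grid_inner_Lap[OF assms] grid_inner_Lap[OF assms(2,1,3)]
  by (simp add: grid_inner_commute)

lemma grid_inner_Lap_self:
  assumes "U \<in> grid_space P" "p_L P > 0" "p_J P > 0"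
  shows "grid_inner P (Lap P U) U = - (grad_norm P U)\<^sup>2"
  using mesh_pos[OF assms(2,3)]
  by (simp add: grid_inner_Lap[OF assms(1,1,3)] grad_norm_def sum_nonneg grid_norm_sq grid_inner_nonneg)

section \<open>Functions of diagonalizable operators\<close>

text \<open>Covers the scalar space (\<open>T = UNIV\<close>) and the symmetric traceless one at
  once, so that the spectral argument is carried out a single time.\<close>

definition grid_space_in :: "gsav_params \<Rightarrow> 'a set \<Rightarrow> ('d::finite, 'a) gridfun set" where
  "grid_space_in P T = {U \<in> grid_space P. \<forall>x. U x \<in> T}"

lemma grid_space_eq_in: "grid_space P = grid_space_in P UNIV"
  by (simp add: grid_space_in_def)

lemma grid_space_S_eq_in: "grid_space_S P = grid_space_in P sym_traceless"
  by (simp add: grid_space_in_def grid_space_S_def)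

text \<open>The maps \<open>pr i\<close> are asked only to yield eigenvectors adding up to the
  input: several \<open>i\<close> may share an eigenvalue, and \<open>pr i U\<close> may vanish.
  Self-adjointness then turns them into the spectral decomposition.\<close>

locale diagonal_operator =
  fixes P :: gsav_params and T :: "'a::real_inner set"
    and B :: "('d::finite, 'a) gridfun \<Rightarrow> ('d, 'a) gridfun"
    and I :: "'i set" and ev :: "'i \<Rightarrow> real"
    and pr :: "'i \<Rightarrow> ('d, 'a) gridfun \<Rightarrow> ('d, 'a) gridfun"
  assumes L: "p_L P > 0" and J: "p_J P > 0" and T: "subspace T"
    and B_add: "\<And>U V. B (\<lambda>x. U x + V x) = (\<lambda>x. B U x + B V x)"
    and B_scaleR: "\<And>c U. B (\<lambda>x. c *\<^sub>R U x) = (\<lambda>x. c *\<^sub>R B U x)"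
    and B_selfadjoint: "\<And>U V. U \<in> grid_space P \<Longrightarrow> V \<in> grid_space P \<Longrightarrow>
          grid_inner P (B U) V = grid_inner P U (B V)"
    and fin: "finite I"
    and pr_eigen: "\<And>U i. U \<in> grid_space_in P T \<Longrightarrow> i \<in> I \<Longrightarrow>
          pr i U \<in> eigenspace (grid_space_in P T) B (ev i)"
    and pr_sum: "\<And>U. U \<in> grid_space_in P T \<Longrightarrow> U = (\<lambda>x. \<Sum>i\<in>I. pr i U x)"
begin

abbreviation V :: "('d, 'a) gridfun set" where "V \<equiv> grid_space_in P T"
abbreviation "E \<equiv> eigenspace V B"

text \<open>Collects all indices with the same eigenvalue; on \<open>V\<close> this is the
  orthogonal projection onto the eigenspace.\<close>

definition eigen_part :: "real \<Rightarrow> ('d, 'a) gridfun \<Rightarrow> ('d, 'a) gridfun" where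
  "eigen_part a U = (\<lambda>x. \<Sum>i\<in>{i\<in>I. ev i = a}. pr i U x)"

lemma V_grid_space: "U \<in> V \<Longrightarrow> U \<in> grid_space P"
  by (simp add: grid_space_in_def)

lemma zero_V: "(\<lambda>x. 0) \<in> V"
  using subspace_0[OF T] by (simp add: grid_space_in_def grid_space_def)

lemma add_V: "U \<in> V \<Longrightarrow> W \<in> V \<Longrightarrow> (\<lambda>x. U x + W x) \<in> V"
  using T by (auto simp: grid_space_in_def grid_space_def subspace_add)

lemma diff_V: "U \<in> V \<Longrightarrow> W \<in> V \<Longrightarrow> (\<lambda>x. U x - W x) \<in> V"
  using T by (auto simp: grid_space_in_def grid_space_def subspace_diff)

lemma scaleR_V: "U \<in> V \<Longrightarrow> (\<lambda>x. c *\<^sub>R U x) \<in> V"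
  using T by (auto simp: grid_space_in_def grid_space_def subspace_scale)

lemma B_zero: "B (\<lambda>x. 0) = (\<lambda>x. 0)"
  using B_scaleR[of 0 "\<lambda>x. 0"] by simp

lemma E_zero: "(\<lambda>x. 0) \<in> E a"
  by (simp add: eigenspace_def zero_V B_zero)

lemma E_add: "U \<in> E a \<Longrightarrow> W \<in> E a \<Longrightarrow> (\<lambda>x. U x + W x) \<in> E a"
  by (simp add: eigenspace_def add_V B_add scaleR_add_right)

lemma E_scaleR: "U \<in> E a \<Longrightarrow> (\<lambda>x. c *\<^sub>R U x) \<in> E a"
  by (simp add: eigenspace_def scaleR_V B_scaleR mult.commute)

lemma E_diff: "U \<in> E a \<Longrightarrow> W \<in> E a \<Longrightarrow> (\<lambda>x. U x - W x) \<in> E a"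
  using E_add[OF _ E_scaleR[of W a "-1"]] by simp

lemma E_sum: "finite S \<Longrightarrow> (\<And>i. i \<in> S \<Longrightarrow> f i \<in> E a) \<Longrightarrow> (\<lambda>x. \<Sum>i\<in>S. f i x) \<in> E a"
  by (induction S rule: finite_induct) (auto simp: E_zero intro: E_add)

lemma E_V: "U \<in> E a \<Longrightarrow> U \<in> V"
  by (simp add: eigenspace_def)

lemma E_B: "U \<in> E a \<Longrightarrow> B U = (\<lambda>x. a *\<^sub>R U x)"
  by (simp add: eigenspace_def)

lemma V_definite: "U \<in> V \<Longrightarrow> grid_inner P U U = 0 \<Longrightarrow> U = (\<lambda>x. 0)"
  using grid_inner_self_eq_0D L J V_grid_space by blast

lemma E_orthogonal:
  assumes U: "U \<in> E a" and W: "W \<in> E b" and "a \<noteq> b"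
  shows "grid_inner P U W = 0"
proof -
  have "a * grid_inner P U W = grid_inner P (B U) W"
    by (simp add: E_B[OF U] grid_inner_scaleR_left)
  also have "\<dots> = grid_inner P U (B W)"
    using B_selfadjoint U W E_V V_grid_space by blast
  also have "\<dots> = b * grid_inner P U W"
    by (simp add: E_B[OF W] grid_inner_commute[of P U] grid_inner_scaleR_left)
  finally show ?thesis using \<open>a \<noteq> b\<close> by simp
qed

text \<open>An eigenvector whose eigenvalue is not among the \<open>ev i\<close> would be orthogonal
  to each of its components \<open>pr i U\<close>, hence to itself.\<close>

lemma finite_eigenvalues: "finite (eigenvalues V B)"
proof (rule finite_subset)
  show "eigenvalues V B \<subseteq> ev ` I"
  proof
    fix a assume "a \<in> eigenvalues V B"
    then obtain U where U: "U \<in> E a" "U \<noteq> (\<lambda>x. 0)" by (auto simp: eigenvalues_def)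
    show "a \<in> ev ` I"
    proof (rule ccontr)
      assume a: "a \<notin> ev ` I"
      have "grid_inner P U U = grid_inner P (\<lambda>x. \<Sum>i\<in>I. pr i U x) U"
        using pr_sum[OF E_V[OF U(1)]] by simp
      also have "\<dots> = 0"
        unfolding grid_inner_sum_left
        using a E_orthogonal[OF pr_eigen[OF E_V[OF U(1)]] U(1)] by (intro sum.neutral) auto
      finally show False using V_definite E_V U by blast
    qed
  qed
qed (use fin in simp)

lemma eigen_part_E: "U \<in> V \<Longrightarrow> eigen_part a U \<in> E a"
  unfolding eigen_part_def using fin pr_eigen by (intro E_sum) auto

lemma eigen_part_sum:
  assumes U: "U \<in> V"
  shows "U = (\<lambda>x. \<Sum>a\<in>eigenvalues V B. eigen_part a U x)"
proof -
  define S where "S = ev ` I \<union> eigenvalues V B"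
  have S: "finite S" using fin finite_eigenvalues by (simp add: S_def)
  have "U x = (\<Sum>a\<in>eigenvalues V B. eigen_part a U x)" for x
  proof -
    have "U x = (\<Sum>i\<in>I. pr i U x)" using pr_sum[OF U] by metis
    also have "\<dots> = (\<Sum>a\<in>S. eigen_part a U x)"
      unfolding eigen_part_def using fin S by (intro sum.group[symmetric]) (auto simp: S_def)
    also have "\<dots> = (\<Sum>a\<in>eigenvalues V B. eigen_part a U x)"
    proof (rule sum.mono_neutral_right[OF S])
      show "\<forall>a\<in>S - eigenvalues V B. eigen_part a U x = 0"
        using eigen_part_E[OF U] by (auto simp: eigenvalues_def) metis
    qed (auto simp: S_def)
    finally show ?thesis .
  qed
  then show ?thesis by blast
qed

text \<open>The remainder \<open>U - eigen_part a U\<close> is a sum of components from other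
  eigenspaces, hence orthogonal to \<open>E a\<close>. This gives existence for the definite
  description in \<open>orth_proj\<close>.\<close>

lemma orth_proj_eq_eigen_part:
  assumes U: "U \<in> V"
  shows "orth_proj P (E a) U = eigen_part a U"
  unfolding orth_proj_def
proof (rule the_equality)
  have orth: "grid_inner P (\<lambda>x. U x - eigen_part a U x) W = 0" if W: "W \<in> E a" for W
  proof -
    have "grid_inner P U W = grid_inner P (\<lambda>x. \<Sum>i\<in>I. pr i U x) W"
      using pr_sum[OF U] by simp
    also have "\<dots> = (\<Sum>i\<in>I. grid_inner P (pr i U) W)" by (rule grid_inner_sum_left)
    also have "\<dots> = (\<Sum>i\<in>{i\<in>I. ev i = a}. grid_inner P (pr i U) W)"
      using fin E_orthogonal[OF pr_eigen[OF U] W] by (intro sum.mono_neutral_right) auto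
    also have "\<dots> = grid_inner P (eigen_part a U) W" by (simp add: eigen_part_def grid_inner_sum_left)
    finally show ?thesis by (simp add: grid_inner_diff_left)
  qed
  then show "eigen_part a U \<in> E a \<and> (\<forall>W\<in>E a. grid_inner P (\<lambda>x. U x - eigen_part a U x) W = 0)"
    using eigen_part_E[OF U] by blast
  fix p assume p: "p \<in> E a \<and> (\<forall>W\<in>E a. grid_inner P (\<lambda>x. U x - p x) W = 0)"
  \<comment> \<open>Uniqueness: the difference of two candidates lies in \<open>E a\<close> and is
    orthogonal to \<open>E a\<close>, so to itself.\<close>
  define D where "D = (\<lambda>x. p x - eigen_part a U x)"
  have D: "D \<in> E a" unfolding D_def using p eigen_part_E[OF U] E_diff by blast
  have "grid_inner P D D = grid_inner P (\<lambda>x. (U x - eigen_part a U x) - (U x - p x)) D"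
    by (simp add: D_def)
  also have "\<dots> = 0"
    using orth[OF D] p D unfolding grid_inner_diff_left[of P "\<lambda>x. U x - eigen_part a U x"] by simp
  finally have "D = (\<lambda>x. 0)" using V_definite E_V[OF D] by blast
  then show "p = eigen_part a U" unfolding D_def by (metis eq_iff_diff_eq_0 ext)
qed

lemma op_fun_eq:
  "U \<in> V \<Longrightarrow> op_fun P V f B U = (\<lambda>x. \<Sum>a\<in>eigenvalues V B. f a *\<^sub>R eigen_part a U x)"
  by (simp add: op_fun_def orth_proj_eq_eigen_part)

lemma E_combination_V:
  assumes "\<And>a. f a \<in> E a" shows "(\<lambda>x. \<Sum>a\<in>eigenvalues V B. f a x) \<in> V"
proof -
  have "(\<lambda>x. \<Sum>a\<in>S. f a x) \<in> V" if "finite S" for S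
    using that
    by (induction S rule: finite_induct) (simp_all add: zero_V add_V[OF E_V[OF assms]])
  then show ?thesis using finite_eigenvalues by blast
qed

lemma op_fun_V: "U \<in> V \<Longrightarrow> op_fun P V f B U \<in> V"
  unfolding op_fun_eq by (intro E_combination_V E_scaleR eigen_part_E)

lemma B_combination:
  assumes "\<And>a. f a \<in> E a"
  shows "B (\<lambda>x. \<Sum>a\<in>eigenvalues V B. f a x) = (\<lambda>x. \<Sum>a\<in>eigenvalues V B. a *\<^sub>R f a x)"
proof -
  have "B (\<lambda>x. \<Sum>a\<in>S. f a x) = (\<lambda>x. \<Sum>a\<in>S. a *\<^sub>R f a x)" if "finite S" for S
    using that
    by (induction S rule: finite_induct) (simp_all add: B_zero B_add E_B[OF assms])
  then show ?thesis using finite_eigenvalues by blast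
qed

lemma grid_inner_combination:
  assumes f: "\<And>a. f a \<in> E a" and g: "\<And>a. g a \<in> E a"
  shows "grid_inner P (\<lambda>x. \<Sum>a\<in>eigenvalues V B. f a x) (\<lambda>x. \<Sum>a\<in>eigenvalues V B. g a x)
    = (\<Sum>a\<in>eigenvalues V B. grid_inner P (f a) (g a))"
proof -
  have "(\<Sum>b\<in>eigenvalues V B. grid_inner P (f a) (g b)) = grid_inner P (f a) (g a)"
    if a: "a \<in> eigenvalues V B" for a
  proof -
    have "(\<Sum>b\<in>eigenvalues V B. grid_inner P (f a) (g b))
        = (\<Sum>b\<in>eigenvalues V B. if b = a then grid_inner P (f a) (g a) else 0)"
      using E_orthogonal[OF f g] by (intro sum.cong) auto
    then show ?thesis using a finite_eigenvalues by simp
  qed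
  then show ?thesis
    by (simp add: grid_inner_sum_left grid_inner_sum_right)
qed

section \<open>The energy inequality for one diagonalizable operator\<close>

lemma etd2_inequality:
  assumes v: "v \<in> V" and N: "N \<in> V" and Y: "Y \<in> V"
    and pos: "\<And>U. U \<in> V \<Longrightarrow> U \<noteq> (\<lambda>x. 0) \<Longrightarrow> 0 < grid_inner P (B U) U"
    and vp: "vp = (\<lambda>x. op_fun P V (\<lambda>z. exp (- z)) B v x + t *\<^sub>R op_fun P V phi1 B N x)"
    and v': "v' = (\<lambda>x. op_fun P V (\<lambda>z. exp (- z)) B v x + t *\<^sub>R op_fun P V phi1 B N x
                + t *\<^sub>R op_fun P V phi2 B Y x)"
  shows "1/2 * grid_inner P (B v') v' - 1/2 * grid_inner P (B v) v
     - 1/2 * (t * grid_inner P (\<lambda>x. 2 *\<^sub>R N x + Y x) (\<lambda>x. v' x - v x))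
     - 1/4 * grid_inner P (B (\<lambda>x. v' x - vp x)) (\<lambda>x. v' x - vp x) \<le> 0"
proof -
  define S where "S = eigenvalues V B"
  define va where "va = (\<lambda>a. eigen_part a v)"
  define na where "na = (\<lambda>a x. t *\<^sub>R eigen_part a N x)"
  define ya where "ya = (\<lambda>a x. t *\<^sub>R eigen_part a Y x)"
  \<comment> \<open>The eigencomponent of \<open>v' - vp\<close>: corrector and predictor differ
    exactly in the \<open>phi2\<close> term.\<close>
  define wa where "wa = (\<lambda>a x. phi2 a *\<^sub>R ya a x)"
  define va' where "va' = (\<lambda>a x. exp (- a) *\<^sub>R va a x + phi1 a *\<^sub>R na a x + wa a x)"
  have E [simp, intro]: "va a \<in> E a" "na a \<in> E a" "ya a \<in> E a" "wa a \<in> E a" "va' a \<in> E a" for a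
    unfolding va'_def wa_def va_def na_def ya_def
    by (intro E_add E_scaleR eigen_part_E v N Y)+
  have v_sum: "v = (\<lambda>x. \<Sum>a\<in>S. va a x)"
    unfolding va_def S_def by (rule eigen_part_sum[OF v])
  have v'_sum: "v' = (\<lambda>x. \<Sum>a\<in>S. va' a x)"
    unfolding v' op_fun_eq[OF v] op_fun_eq[OF N] op_fun_eq[OF Y] va'_def wa_def va_def na_def ya_def S_def
    by (simp add: sum.distrib scaleR_sum_right mult.commute)
  have d_sum: "(\<lambda>x. v' x - v x) = (\<lambda>x. \<Sum>a\<in>S. va' a x - va a x)"
    unfolding v_sum v'_sum by (simp add: sum_subtractf)
  have w_sum: "(\<lambda>x. v' x - vp x) = (\<lambda>x. \<Sum>a\<in>S. wa a x)"
    unfolding v' vp op_fun_eq[OF Y] wa_def ya_def S_def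
    by (simp add: scaleR_sum_right mult.commute)
  have "N = (\<lambda>x. \<Sum>a\<in>S. eigen_part a N x)" "Y = (\<lambda>x. \<Sum>a\<in>S. eigen_part a Y x)"
    unfolding S_def using eigen_part_sum N Y by blast+
  then have "N x = (\<Sum>a\<in>S. eigen_part a N x)" "Y x = (\<Sum>a\<in>S. eigen_part a Y x)" for x
    by metis+
  then have n_sum: "(\<lambda>x. t *\<^sub>R (2 *\<^sub>R N x + Y x)) = (\<lambda>x. \<Sum>a\<in>S. 2 *\<^sub>R na a x + ya a x)"
    unfolding na_def ya_def
    by (simp add: scaleR_add_right sum.distrib scaleR_sum_right mult.commute)
  have E2: "(\<lambda>x. 2 *\<^sub>R na a x + ya a x) \<in> E a" "(\<lambda>x. va' a x - va a x) \<in> E a" for a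
    by (intro E_add E_scaleR E_diff E)+
  have B_inner: "grid_inner P (B (\<lambda>x. \<Sum>a\<in>S. f a x)) (\<lambda>x. \<Sum>a\<in>S. f a x)
      = (\<Sum>a\<in>S. a * grid_inner P (f a) (f a))" if f: "\<And>a. f a \<in> E a" for f
    using grid_inner_combination[of "\<lambda>a x. a *\<^sub>R f a x" f] f
    by (simp add: S_def B_combination E_scaleR grid_inner_scaleR_left)
  have "t * grid_inner P (\<lambda>x. 2 *\<^sub>R N x + Y x) (\<lambda>x. v' x - v x)
      = grid_inner P (\<lambda>x. t *\<^sub>R (2 *\<^sub>R N x + Y x)) (\<lambda>x. v' x - v x)"
    by (simp only: grid_inner_scaleR_left)
  also have "\<dots> = (\<Sum>a\<in>S. grid_inner P (\<lambda>x. 2 *\<^sub>R na a x + ya a x) (\<lambda>x. va' a x - va a x))"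
    unfolding n_sum d_sum S_def by (rule grid_inner_combination[OF E2])
  finally have N_inner: "t * grid_inner P (\<lambda>x. 2 *\<^sub>R N x + Y x) (\<lambda>x. v' x - v x) = \<dots>" .
  have le: "1/2 * (a * grid_inner P (va' a) (va' a)) - 1/2 * (a * grid_inner P (va a) (va a))
      - 1/2 * grid_inner P (\<lambda>x. 2 *\<^sub>R na a x + ya a x) (\<lambda>x. va' a x - va a x)
      - 1/4 * (a * grid_inner P (wa a) (wa a)) \<le> 0" (is "?q \<le> 0") if "a \<in> S" for a
  proof -
    \<comment> \<open>Testing \<open>pos\<close> with an eigenvector shows that every eigenvalue is
      positive, as the scalar estimate requires.\<close>
    obtain U where U: "U \<in> E a" "U \<noteq> (\<lambda>x. 0)" using \<open>a \<in> S\<close> by (auto simp: S_def eigenvalues_def)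
    then have "0 < a * grid_inner P U U"
      using pos[OF E_V[OF U(1)]] by (simp add: E_B[OF U(1)] grid_inner_scaleR_left)
    moreover have h: "mesh P > 0" using mesh_pos L J by blast
    ultimately have a: "a > 0"
      using grid_inner_nonneg[OF h, of U] by (simp add: zero_less_mult_iff)
    \<comment> \<open>Every vector in \<open>?q\<close> belongs to the same eigenvalue, so
      \<open>?q\<close> is a sum over grid points to which \<open>etd2_pointwise\<close> applies
      termwise.\<close>
    have "?q = mesh P ^ CARD('d) * (\<Sum>x\<in>cell P. a / 2 * (va' a x \<bullet> va' a x) - a / 2 * (va a x \<bullet> va a x)
        - 1/2 * ((2 *\<^sub>R na a x + ya a x) \<bullet> (va' a x - va a x)) - a / 4 * (wa a x \<bullet> wa a x))"
      unfolding grid_inner_def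
      by (simp add: sum_subtractf right_diff_distrib mult_ac flip: sum_distrib_left sum_divide_distrib)
    also have "\<dots> \<le> 0"
      using h etd2_pointwise[OF a, of "va' a _" "va a _" "na a _" "ya a _"]
      by (intro mult_nonneg_nonpos sum_nonpos) (auto simp: va'_def wa_def)
    finally show ?thesis .
  qed
  have "1/2 * grid_inner P (B v') v' - 1/2 * grid_inner P (B v) v
     - 1/2 * (t * grid_inner P (\<lambda>x. 2 *\<^sub>R N x + Y x) (\<lambda>x. v' x - v x))
     - 1/4 * grid_inner P (B (\<lambda>x. v' x - vp x)) (\<lambda>x. v' x - vp x)
    = (\<Sum>a\<in>S. 1/2 * (a * grid_inner P (va' a) (va' a)) - 1/2 * (a * grid_inner P (va a) (va a))
      - 1/2 * grid_inner P (\<lambda>x. 2 *\<^sub>R na a x + ya a x) (\<lambda>x. va' a x - va a x)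
      - 1/4 * (a * grid_inner P (wa a) (wa a)))"
    unfolding N_inner w_sum unfolding v_sum v'_sum B_inner[OF E(1)] B_inner[OF E(5)] B_inner[OF E(4)]
    by (simp only: sum_subtractf sum_distrib_left)
  also have "\<dots> \<le> 0" using le by (rule sum_nonpos)
  finally show ?thesis .
qed

end

section \<open>Discrete Fourier modes\<close>

text \<open>A geometric sum of powers of the root of unity \<open>w\<close>, where
  \<open>w ^ J = 1\<close>, and \<open>w = 1\<close> exactly if \<open>J\<close> divides
  \<open>z\<close>.\<close>

lemma sum_cis_multiples:
  assumes J: "J > 0"
  shows "(\<Sum>m\<in>{0..<int J}. cis (2 * pi * of_int (m * z) / real J)) = (if int J dvd z then of_nat J else 0)"
proof -
  define w where "w = cis (2 * pi * (of_int z / real J))"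
  have pow: "cis (2 * pi * of_int (int m * z) / real J) = w ^ m" for m
    by (simp add: w_def Complex.DeMoivre mult_ac)
  have "(\<Sum>m\<in>{0..<int J}. cis (2 * pi * of_int (m * z) / real J)) = (\<Sum>m<J. w ^ m)"
    by (rule sum.reindex_bij_witness[of _ int nat]) (auto simp flip: pow)
  also have "\<dots> = (if int J dvd z then of_nat J else 0)"
  proof (cases "int J dvd z")
    case True
    then obtain n where "z = int J * n" by blast
    then have "w = 1" using J by (simp add: w_def)
    then show ?thesis using True by simp
  next
    case False
    have "w \<noteq> 1"
    proof
      assume "w = 1"
      then obtain n :: int where "2 * pi * (of_int z / real J) = of_int n * (2 * pi)"
        by (auto simp: w_def cis_eq_1_iff)
      then have "of_int z = (of_int (n * int J) :: real)" using J by (simp add: field_simps)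
      then have "z = n * int J" by linarith
      then show False using False by simp
    qed
    moreover have "w ^ J = 1"
      using J by (simp add: w_def Complex.DeMoivre mult.left_commute)
    ultimately show ?thesis using False by (simp add: sum_gp_strict)
  qed
  finally show ?thesis .
qed

definition phase :: "gsav_params \<Rightarrow> int^'d \<Rightarrow> int^'d::finite \<Rightarrow> real" where
  "phase P xi z = (\<Sum>k\<in>UNIV. 2 * pi * of_int (xi $ k * z $ k) / real (p_J P))"

lemma cis_sum: "finite S \<Longrightarrow> cis (\<Sum>k\<in>S. f k) = (\<Prod>k\<in>S. cis (f k))"
  by (induction S rule: finite_induct) (simp_all flip: cis_mult)

lemma sum_cell_prod:
  fixes f :: "'d::finite \<Rightarrow> int \<Rightarrow> complex"
  shows "(\<Sum>xi\<in>cell P. \<Prod>k\<in>UNIV. f k (xi $ k)) = (\<Prod>k\<in>(UNIV::'d set). \<Sum>m\<in>{0..<int (p_J P)}. f k m)"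
proof -
  have "(\<Prod>k\<in>(UNIV::'d set). \<Sum>m\<in>{0..<int (p_J P)}. f k m)
      = (\<Sum>g\<in>PiE UNIV (\<lambda>_. {0..<int (p_J P)}). \<Prod>k\<in>UNIV. f k (g k))"
    by (intro prod_sum_PiE) auto
  also have "\<dots> = (\<Sum>xi\<in>cell P. \<Prod>k\<in>UNIV. f k (xi $ k))"
    by (rule sum.reindex_bij_witness[of _ vec_nth vec_lambda]) (auto simp: cell_def)
  finally show ?thesis by simp
qed

text \<open>Discrete orthogonality of the modes: the complex sum factors over the coordinates into
  geometric sums, and the real part is taken at the end.\<close>

lemma sum_cos_phase:
  fixes x y :: "int^'d::finite"
  assumes J: "p_J P > 0" and x: "x \<in> cell P" and y: "y \<in> cell P"
  shows "(\<Sum>xi\<in>cell P. cos (phase P xi (x - y))) = (if x = y then real (p_J P) ^ CARD('d) else 0)"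
proof -
  have "(\<Sum>xi\<in>cell P. cis (phase P xi (x - y)))
      = (\<Prod>k\<in>(UNIV::'d set). if int (p_J P) dvd (x - y) $ k then of_nat (p_J P) else 0)"
    unfolding phase_def cis_sum[OF finite]
    by (subst sum_cell_prod[of "\<lambda>k m. cis (2 * pi * of_int (m * (x - y) $ k) / real (p_J P))"])
      (simp only: sum_cis_multiples[OF J])
  also have "\<dots> = (if x = y then of_nat (p_J P) ^ CARD('d) else 0)"
  proof (cases "x = y")
    case False
    then obtain k where k: "x $ k \<noteq> y $ k" by (auto simp: vec_eq_iff)
    have "0 \<le> x $ k" "x $ k < int (p_J P)" "0 \<le> y $ k" "y $ k < int (p_J P)"
      using x y by (auto simp: cell_def)
    \<comment> \<open>Coordinates of two cell points differ by less than the period, so divisibility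
      by it would force them to agree.\<close>
    then have "\<bar>(x - y) $ k\<bar> < int (p_J P)" by auto
    then have "\<not> int (p_J P) dvd (x - y) $ k"
      using k zdvd_not_zless[of "\<bar>(x - y) $ k\<bar>" "int (p_J P)"] by auto
    then show ?thesis using False by (auto intro!: prod_zero)
  qed simp
  finally have "Re (\<Sum>xi\<in>cell P. cis (phase P xi (x - y)))
      = Re (if x = y then of_nat (p_J P) ^ CARD('d) else 0)" by simp
  then show ?thesis by (simp add: Re_sum flip: of_nat_power)
qed

text \<open>The mean of the complex Fourier projections at \<open>xi\<close> and \<open>- xi\<close>. It is real, and as both modes
  have the same Laplace eigenvalue, its values are still eigenvectors.\<close>

definition dft_proj :: "gsav_params \<Rightarrow> int^'d \<Rightarrow> ('d::finite, 'a::real_vector) gridfun \<Rightarrow> ('d, 'a) gridfun" where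
  "dft_proj P xi U = (\<lambda>x. (1 / real (p_J P) ^ CARD('d)) *\<^sub>R (\<Sum>y\<in>cell P. cos (phase P xi (x - y)) *\<^sub>R U y))"

text \<open>The symbol of minus the discrete Laplacian, hence the sign in
  \<open>Lap_dft_proj\<close>.\<close>

definition Lap_symbol :: "gsav_params \<Rightarrow> int^'d::finite \<Rightarrow> real" where
  "Lap_symbol P xi = (\<Sum>k\<in>UNIV. 2 - 2 * cos (2 * pi * of_int (xi $ k) / real (p_J P))) / (mesh P)\<^sup>2"

lemma phase_add_axis:
  "phase P xi (z + axis k n) = phase P xi z + 2 * pi * of_int (xi $ k * n) / real (p_J P)"
proof -
  have "phase P xi (z + axis k n) = (\<Sum>i\<in>UNIV. 2 * pi * of_int (xi $ i * z $ i) / real (p_J P)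
      + (if i = k then 2 * pi * of_int (xi $ k * n) / real (p_J P) else 0))"
    unfolding phase_def
    by (intro sum.cong refl) (simp add: axis_def distrib_left add_divide_distrib)
  then show ?thesis by (simp add: sum.distrib phase_def)
qed

text \<open>A shift by one period changes the phase by an integer multiple of 2 pi.\<close>

lemma dft_proj_in_grid_space: "p_J P > 0 \<Longrightarrow> dft_proj P xi U \<in> grid_space P"
proof -
  assume J: "p_J P > 0"
  have "cos (phase P xi (x + axis k (int (p_J P)) - y)) = cos (phase P xi (x - y))" for x y and k
  proof -
    have "x + axis k (int (p_J P)) - y = x - y + axis k (int (p_J P))" by (simp add: algebra_simps)
    then have "phase P xi (x + axis k (int (p_J P)) - y) = phase P xi (x - y) + 2 * pi * of_int (xi $ k)"
      using J by (simp only: phase_add_axis) simp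
    then show ?thesis by (simp add: cos_add)
  qed
  then show ?thesis by (simp add: dft_proj_def grid_space_def)
qed

lemma dft_proj_in_grid_space_in:
  assumes "p_J P > 0" "subspace T" "U \<in> grid_space_in P T"
  shows "dft_proj P xi U \<in> grid_space_in P T"
  using dft_proj_in_grid_space[OF assms(1)] assms(2,3)
  by (auto simp: grid_space_in_def dft_proj_def intro!: subspace_scale subspace_sum)

text \<open>Fourier inversion: after exchanging the sums, the kernel is a discrete delta on the cell
  by \<open>sum_cos_phase\<close>; periodicity does the rest.\<close>

lemma dft_proj_sum:
  fixes U :: "('d::finite, 'a::real_vector) gridfun"
  assumes J: "p_J P > 0" and U: "U \<in> grid_space P"
  shows "U = (\<lambda>x. \<Sum>xi\<in>cell P. dft_proj P xi U x)"
proof (rule grid_space_eqI[OF U _ J])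
  show "(\<lambda>x. \<Sum>xi\<in>cell P. dft_proj P xi U x) \<in> grid_space P"
    unfolding grid_space_def by (simp add: grid_spaceD[OF dft_proj_in_grid_space[OF J]])
  fix x :: "int^'d" assume x: "x \<in> cell P"
  have "(\<Sum>xi\<in>cell P. dft_proj P xi U x)
      = (1 / real (p_J P) ^ CARD('d)) *\<^sub>R (\<Sum>y\<in>cell P. (\<Sum>xi\<in>cell P. cos (phase P xi (x - y))) *\<^sub>R U y)"
    unfolding dft_proj_def scaleR_sum_right[symmetric] scaleR_sum_left
    by (subst sum.swap) simp
  also have "(\<Sum>y\<in>cell P. (\<Sum>xi\<in>cell P. cos (phase P xi (x - y))) *\<^sub>R U y)
      = (\<Sum>y\<in>cell P. if y = x then real (p_J P) ^ CARD('d) *\<^sub>R U x else 0)"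
    using sum_cos_phase[OF J x] by (intro sum.cong) auto
  finally show "U x = (\<Sum>xi\<in>cell P. dft_proj P xi U x)" using x J by simp
qed

lemma Lap_dft_proj: "Lap P (dft_proj P xi U) = (\<lambda>x. (- Lap_symbol P xi) *\<^sub>R dft_proj P xi U x)"
proof
  fix x
  let ?c = "\<lambda>k. cos (2 * pi * of_int (xi $ k) / real (p_J P))"
  \<comment> \<open>The sine terms of the two opposite shifts cancel, so the real cosine kernel is
    itself an eigenfunction of the symmetric second difference.\<close>
  have cos2: "cos (phase P xi (x + axis k 1 - y)) + cos (phase P xi (x - axis k 1 - y))
      = 2 * ?c k * cos (phase P xi (x - y))" for k y
  proof -
    have shifts: "x + axis k 1 - y = x - y + axis k 1" "x - axis k 1 - y = x - y + axis k (-1)"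
      by (simp_all add: vec_eq_iff axis_def)
    show ?thesis unfolding shifts phase_add_axis by (simp add: cos_add cos_diff)
  qed
  have "dft_proj P xi U (x + axis k 1) + dft_proj P xi U (x - axis k 1) - 2 *\<^sub>R dft_proj P xi U x
     = (- (2 - 2 * ?c k)) *\<^sub>R dft_proj P xi U x" for k
  proof -
    have "dft_proj P xi U (x + axis k 1) + dft_proj P xi U (x - axis k 1) = (2 * ?c k) *\<^sub>R dft_proj P xi U x"
      unfolding dft_proj_def scaleR_add_right[symmetric] sum.distrib[symmetric] scaleR_add_left[symmetric] cos2
      by (simp add: scaleR_sum_right mult_ac)
    then show ?thesis by (simp add: algebra_simps)
  qed
  note eq = this
  show "Lap P (dft_proj P xi U) x = (- Lap_symbol P xi) *\<^sub>R dft_proj P xi U x"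
    unfolding Lap_eq eq scaleR_sum_left[symmetric] sum_negf Lap_symbol_def by simp
qed

lemma Lap_add: "Lap P (\<lambda>x. U x + V x) = (\<lambda>x. Lap P U x + Lap P V x)"
proof
  fix x
  have "Lap P (\<lambda>x. U x + V x) x = (1 / (mesh P)\<^sup>2) *\<^sub>R (\<Sum>k\<in>UNIV.
     (U (x + axis k 1) + U (x - axis k 1) - 2 *\<^sub>R U x) + (V (x + axis k 1) + V (x - axis k 1) - 2 *\<^sub>R V x))"
    unfolding Lap_eq by (intro arg_cong[of _ _ "scaleR _"] sum.cong refl) (simp add: scaleR_2)
  then show "Lap P (\<lambda>x. U x + V x) x = Lap P U x + Lap P V x"
    by (simp only: sum.distrib scaleR_add_right Lap_eq)
qed

lemma Lap_scaleR: "Lap P (\<lambda>x. c *\<^sub>R U x) = (\<lambda>x. c *\<^sub>R Lap P U x)"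
proof
  fix x
  have "Lap P (\<lambda>x. c *\<^sub>R U x) x
     = (1 / (mesh P)\<^sup>2) *\<^sub>R (\<Sum>k\<in>UNIV. c *\<^sub>R (U (x + axis k 1) + U (x - axis k 1) - 2 *\<^sub>R U x))"
    unfolding Lap_eq
    by (intro arg_cong[of _ _ "scaleR _"] sum.cong refl) (simp add: scaleR_add_right scaleR_diff_right mult.commute)
  then show "Lap P (\<lambda>x. c *\<^sub>R U x) x = c *\<^sub>R Lap P U x"
    by (simp add: Lap_eq mult.commute flip: scaleR_sum_right)
qed

section \<open>Energy dissipation\<close>

lemma L_op_add: "L_op P (\<lambda>x. U x + V x) = (\<lambda>x. L_op P U x + L_op P V x)"
  by (rule ext) (simp add: L_op_def Lap_add scaleR_add_right)

lemma L_op_scaleR: "L_op P (\<lambda>x. c *\<^sub>R U x) = (\<lambda>x. c *\<^sub>R L_op P U x)"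
  by (rule ext) (simp add: L_op_def Lap_scaleR scaleR_diff_right mult.commute)

lemma D_op_add: "D_op P (\<lambda>x. U x + V x) = (\<lambda>x. D_op P U x + D_op P V x)"
  by (rule ext) (simp add: D_op_def Lap_add distrib_left)

lemma D_op_scaleR:
  fixes U :: "('d::finite, real) gridfun"
  shows "D_op P (\<lambda>x. c * U x) = (\<lambda>x. c * D_op P U x)"
proof -
  have "Lap P (\<lambda>x. c * W x) = (\<lambda>x. c * Lap P W x)" for W :: "('d, real) gridfun"
    using Lap_scaleR[of P c W] by simp
  then show ?thesis by (simp add: D_op_def distrib_left mult_ac)
qed

lemma grid_inner_L_op:
  "grid_inner P (L_op P U) V = - p_K P * grid_inner P (Lap P U) V + p_kappa P * grid_inner P U V"
  unfolding L_op_def by (simp only: grid_inner_add_left grid_inner_scaleR_left)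

lemma grid_inner_D_op:
  assumes "U \<in> grid_space P" "V \<in> grid_space P" "p_J P > 0"
  shows "grid_inner P (D_op P U) V = 2 * p_B0 P * grid_inner P (Lap P U) (Lap P V) + p_kappa P * grid_inner P U V"
proof -
  have "grid_inner P (D_op P U) V = 2 * p_B0 P * grid_inner P (Lap P (Lap P U)) V + p_kappa P * grid_inner P U V"
    unfolding D_op_def real_scaleR_def[symmetric] grid_inner_add_left grid_inner_scaleR_left by simp
  then show ?thesis
    using Lap_selfadjoint[OF Lap_in_grid_space[OF assms(1)] assms(2,3)] by simp
qed

lemma L_op_energy:
  assumes "U \<in> grid_space P" "p_L P > 0" "p_J P > 0"
  shows "grid_inner P (L_op P U) U = p_K P * (grad_norm P U)\<^sup>2 + p_kappa P * (grid_norm P U)\<^sup>2"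
  using mesh_pos[OF assms(2,3)]
  by (simp add: grid_inner_L_op grid_inner_Lap_self[OF assms] grid_norm_sq)

lemma D_op_energy:
  assumes "U \<in> grid_space P" "p_L P > 0" "p_J P > 0"
  shows "grid_inner P (D_op P U) U = 2 * p_B0 P * (grid_norm P (Lap P U))\<^sup>2 + p_kappa P * (grid_norm P U)\<^sup>2"
  using mesh_pos[OF assms(2,3)]
  by (simp add: grid_inner_D_op[OF assms(1,1,3)] grid_norm_sq)

lemma grid_norm_sq_pos:
  assumes "U \<in> grid_space P" "p_L P > 0" "p_J P > 0" "U \<noteq> (\<lambda>x. 0)"
  shows "0 < (grid_norm P U)\<^sup>2"
  using grid_inner_self_eq_0D[OF assms(1-3)] grid_inner_nonneg[OF mesh_pos[OF assms(2,3)], of U] assms(4)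
  by (auto simp: grid_norm_sq[OF mesh_pos[OF assms(2,3)]] less_le)

lemma subspace_sym_traceless: "subspace (sym_traceless :: (real^'d^'d::finite) set)"
  by (auto simp: subspace_def sym_traceless_def transpose_def vec_eq_iff trace_def sum.distrib
      simp flip: sum_distrib_left)

text \<open>The Laplacian acts entrywise, so scalar modes with matrix coefficients diagonalize it;
  real combinations of values stay symmetric and traceless.\<close>

lemma diagonal_operator_L:
  assumes L: "p_L P > 0" and J: "p_J P > 0"
  shows "diagonal_operator P (sym_traceless :: (real^'d^'d::finite) set) (\<lambda>Q x. tau *\<^sub>R L_op P Q x)
    (cell P) (\<lambda>xi. tau * (p_K P * Lap_symbol P xi + p_kappa P)) (dft_proj P)"
proof
  show "subspace (sym_traceless :: (real^'d^'d) set)" by (rule subspace_sym_traceless)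
  fix U V :: "('d, real^'d^'d) gridfun"
  assume "U \<in> grid_space P" "V \<in> grid_space P"
  then show "grid_inner P (\<lambda>x. tau *\<^sub>R L_op P U x) V = grid_inner P U (\<lambda>x. tau *\<^sub>R L_op P V x)"
    using Lap_selfadjoint[OF _ _ J, of U V]
    by (simp add: grid_inner_commute[of P U] grid_inner_scaleR_left grid_inner_L_op)
next
  fix U :: "('d, real^'d^'d) gridfun" and xi :: "int^'d"
  assume U: "U \<in> grid_space_in P sym_traceless"
  then show "dft_proj P xi U \<in> eigenspace (grid_space_in P sym_traceless) (\<lambda>Q x. tau *\<^sub>R L_op P Q x)
      (tau * (p_K P * Lap_symbol P xi + p_kappa P))"
    using dft_proj_in_grid_space_in[OF J subspace_sym_traceless U]
    by (simp add: eigenspace_def L_op_def Lap_dft_proj algebra_simps)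
  show "U = (\<lambda>x. \<Sum>xi\<in>cell P. dft_proj P xi U x)"
    using U by (intro dft_proj_sum[OF J]) (simp add: grid_space_in_def)
qed (simp_all add: L J L_op_add L_op_scaleR scaleR_add_right mult.commute)

lemma diagonal_operator_D:
  assumes L: "p_L P > 0" and J: "p_J P > 0"
  shows "diagonal_operator P (UNIV :: real set) (\<lambda>u x. tau * D_op P u x)
    (cell P :: (int^'d::finite) set) (\<lambda>xi. tau * (2 * p_B0 P * (Lap_symbol P xi)\<^sup>2 + p_kappa P)) (dft_proj P)"
proof
  fix U V :: "('d, real) gridfun"
  assume "U \<in> grid_space P" "V \<in> grid_space P"
  then show "grid_inner P (\<lambda>x. tau * D_op P U x) V = grid_inner P U (\<lambda>x. tau * D_op P V x)"
    using grid_inner_scaleR_left[of P tau "D_op P U" V] grid_inner_scaleR_left[of P tau "D_op P V" U]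
    by (simp add: grid_inner_commute[of P U] grid_inner_D_op J)
      (simp add: grid_inner_commute)
next
  fix U :: "('d, real) gridfun" and xi :: "int^'d"
  assume U: "U \<in> grid_space_in P UNIV"
  have Lap2: "Lap P (Lap P (dft_proj P xi U)) = (\<lambda>x. (Lap_symbol P xi)\<^sup>2 * dft_proj P xi U x)"
    by (simp only: Lap_dft_proj Lap_scaleR) (simp add: power2_eq_square mult.assoc)
  show "dft_proj P xi U \<in> eigenspace (grid_space_in P UNIV) (\<lambda>u x. tau * D_op P u x)
      (tau * (2 * p_B0 P * (Lap_symbol P xi)\<^sup>2 + p_kappa P))"
    using dft_proj_in_grid_space_in[OF J subspace_UNIV U]
    by (simp add: eigenspace_def D_op_def Lap2 algebra_simps)
  show "U = (\<lambda>x. \<Sum>xi\<in>cell P. dft_proj P xi U x)"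
    using U by (intro dft_proj_sum[OF J]) (simp add: grid_space_in_def)
qed (simp_all add: L J D_op_add D_op_scaleR distrib_left mult_ac)

section \<open>Invariance of the grid spaces under the nonlinear terms\<close>

lemma Hess_sym: "transpose (Hess P u x) = Hess P u x"
  by (simp add: Hess_def transpose_def vec_eq_iff D_cen_commute)

lemma Hess_in_grid_space: "u \<in> grid_space P \<Longrightarrow> Hess P u \<in> grid_space P"
  using D_cen_in_grid_space[OF D_cen_in_grid_space[of u P]]
  by (simp add: grid_space_def Hess_def)

lemma div2_in_grid_space:
  assumes "Phi \<in> grid_space P" shows "div2 P Phi \<in> grid_space P"
proof -
  have "D_cen P i (D_cen P j (\<lambda>y. Phi y $ i $ j)) \<in> grid_space P" for i j
    by (intro D_cen_in_grid_space grid_space_comp[OF assms])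
  then show ?thesis by (simp add: grid_space_def div2_def)
qed

lemma M_fun_in_grid_space: "Q \<in> grid_space P \<Longrightarrow> M_fun P Q \<in> grid_space P"
  by (simp add: grid_space_def M_fun_def)

lemma traceless_part_sym_traceless:
  fixes A :: "real^'d^'d::finite"
  assumes "transpose A = A"
  shows "traceless_part A \<in> sym_traceless"
proof -
  have "trace (traceless_part A) = 0"
    by (simp add: traceless_part_def trace_sub) (simp add: trace_def mat_def)
  moreover have "transpose (traceless_part A) = traceless_part A"
    using assms by (auto simp: traceless_part_def transpose_def vec_eq_iff mat_def)
  ultimately show ?thesis by (simp add: sym_traceless_def)
qed

text \<open>The square of \<open>Q x\<close> and the scaled Hessian are symmetric, and
  \<open>traceless_part\<close> removes their traces. Membership matters because
  \<open>op_fun\<close> has been evaluated only for inputs in the space of the operator.\<close>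

lemma H_term_in_grid_space_S:
  assumes Q: "Q \<in> grid_space_S P" and u: "u \<in> grid_space P"
  shows "H_term P Q u \<in> grid_space_S P"
proof -
  have Qg: "Q \<in> grid_space P" and QS: "Q x \<in> sym_traceless" for x
    using Q by (auto simp: grid_space_S_def)
  have "transpose (Q x ** Q x) = Q x ** Q x" for x
    using QS[of x] by (simp add: sym_traceless_def matrix_transpose_mul)
  moreover have "transpose (u x *\<^sub>R Hess P u x) = u x *\<^sub>R Hess P u x" for x
    using Hess_sym[of P u x] by (simp add: transpose_def vec_eq_iff)
  ultimately have "H_term P Q u x \<in> sym_traceless" for x
    unfolding H_term_def
    by (intro subspace_add subspace_diff subspace_scale subspace_sym_traceless
        traceless_part_sym_traceless QS) auto
  moreover have "H_term P Q u \<in> grid_space P"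
    using grid_spaceD[OF Qg] grid_spaceD[OF u] grid_spaceD[OF Hess_in_grid_space[OF u]]
    by (simp add: grid_space_def H_term_def)
  ultimately show ?thesis by (simp add: grid_space_S_def)
qed

lemma mu_term_in_grid_space:
  assumes Q: "Q \<in> grid_space P" and u: "u \<in> grid_space P"
  shows "mu_term P Q u \<in> grid_space P"
  using grid_spaceD[OF u] grid_spaceD[OF M_fun_in_grid_space[OF Q]] grid_spaceD[OF Hess_in_grid_space[OF u]]
    grid_spaceD[OF div2_in_grid_space[OF grid_space_comp2[OF u M_fun_in_grid_space[OF Q], of scaleR]]]
  by (simp add: grid_space_def mu_term_def)

lemma N_Q_in_grid_space_S:
  "Q \<in> grid_space_S P \<Longrightarrow> u \<in> grid_space P \<Longrightarrow> N_Q P (Q, u, s) \<in> grid_space_S P"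
  using H_term_in_grid_space_S[of Q P u]
  by (auto simp: N_Q_def grid_space_S_def grid_space_def intro!: subspace_scale subspace_sym_traceless)

lemma N_u_in_grid_space:
  "Q \<in> grid_space_S P \<Longrightarrow> u \<in> grid_space P \<Longrightarrow> N_u P (Q, u, s) \<in> grid_space P"
  using mu_term_in_grid_space[of Q P u] by (auto simp: N_u_def grid_space_S_def grid_space_def)

lemma grid_restrict_in_grid_space:
  assumes "p_J P > 0" and F: "\<And>x k. F (x + axis k (p_L P)) = F x"
  shows "grid_restrict P F \<in> grid_space P"
proof -
  \<comment> \<open>\<open>p_J P\<close> mesh widths make up one period
    \<open>p_L P\<close>.\<close>
  have "(\<chi> i. mesh P * of_int ((x + axis k (int (p_J P))) $ i))
      = (\<chi> i. mesh P * of_int (x $ i)) + axis k (p_L P)" for x :: "int^'a" and k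
    using assms(1) by (simp add: vec_eq_iff axis_def mesh_def distrib_left)
  then show ?thesis using F by (simp add: grid_space_def grid_restrict_def)
qed

section \<open>Energy balance of one step and induction over the steps\<close>

lemma energy_eq:
  assumes "Q \<in> grid_space P" "u \<in> grid_space P" "p_L P > 0" "p_J P > 0"
  shows "energy P (Q, u, s) = 1/2 * grid_inner P (L_op P Q) Q + 1/2 * grid_inner P (D_op P u) u + s"
  using assms by (simp add: energy_def L_op_energy D_op_energy algebra_simps)

text \<open>The invariant of the iteration, which places both fields in the spaces of the functional
  calculus.\<close>

definition admissible :: "gsav_params \<Rightarrow> 'd::finite state \<Rightarrow> bool" where
  "admissible P X \<longleftrightarrow> fst X \<in> grid_space_S P \<and> fst (snd X) \<in> grid_space P"

lemma gsav_etd2_step_dissipation: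
  fixes X :: "'d::finite state"
  assumes L: "p_L P > 0" and J: "p_J P > 0" and par: "p_K P > 0" "p_B0 P > 0" "p_kappa P > 0"
    and tau: "tau > 0" and adm: "admissible P X"
  shows "admissible P (gsav_etd2_step P tau X)"
    and "energy P (gsav_etd2_step P tau X) \<le> energy P X"
proof -
  obtain Q u s where X: "X = (Q, u, s)" by (metis prod_cases3)
  interpret L: diagonal_operator P "sym_traceless :: (real^'d^'d) set" "\<lambda>Q x. tau *\<^sub>R L_op P Q x"
    "cell P" "\<lambda>xi. tau * (p_K P * Lap_symbol P xi + p_kappa P)" "dft_proj P"
    by (rule diagonal_operator_L[OF L J])
  interpret D: diagonal_operator P "UNIV :: real set" "\<lambda>(u :: ('d, real) gridfun) x. tau * D_op P u x"
    "cell P" "\<lambda>xi. tau * (2 * p_B0 P * (Lap_symbol P xi)\<^sup>2 + p_kappa P)" "dft_proj P"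
    by (rule diagonal_operator_D[OF L J])
  note S = grid_space_S_eq_in[of P, symmetric]
  note G = grid_space_eq_in[of P, symmetric]
  have Q: "Q \<in> grid_space_S P" and u: "u \<in> grid_space P" using adm by (auto simp: admissible_def X)
  define NQ where "NQ = N_Q P X"
  define Nu where "Nu = N_u P X"
  have NQ: "NQ \<in> grid_space_S P" and Nu: "Nu \<in> grid_space P"
    using N_Q_in_grid_space_S[OF Q u] N_u_in_grid_space[OF Q u] by (auto simp: NQ_def Nu_def X)
  define Qp where "Qp = (\<lambda>x. fun_L P tau (\<lambda>z. exp (- z)) Q x + tau *\<^sub>R fun_L P tau phi1 NQ x)"
  define up where "up = (\<lambda>x. fun_D P tau (\<lambda>z. exp (- z)) u x + tau * fun_D P tau phi1 Nu x)"
  define sp where "sp = s - grid_inner P NQ (\<lambda>x. Qp x - Q x) - grid_inner P Nu (\<lambda>x. up x - u x)"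
  have pred: "predictor P tau X = (Qp, up, sp)"
    unfolding predictor_def NQ_def Nu_def Qp_def up_def sp_def X by (simp add: Let_def)
  have L_in: "fun_L P tau f U \<in> grid_space_S P" if "U \<in> grid_space_S P" for f and U :: "('d, real^'d^'d) gridfun"
    using L.op_fun_V[of U f] that by (simp add: fun_L_def S)
  have D_in: "fun_D P tau f U \<in> grid_space P" if "U \<in> grid_space P" for f and U :: "('d, real) gridfun"
    using D.op_fun_V[of U f] that by (simp add: fun_D_def G)
  note S_intros = L.add_V[folded grid_space_S_eq_in] L.scaleR_V[folded grid_space_S_eq_in]
    L.diff_V[folded grid_space_S_eq_in] L_in
  note G_intros = D.add_V[folded grid_space_eq_in] D.scaleR_V[folded grid_space_eq_in, unfolded real_scaleR_def]
    D.diff_V[folded grid_space_eq_in] D_in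
  have Qp: "Qp \<in> grid_space_S P" unfolding Qp_def by (intro S_intros Q NQ)
  have up: "up \<in> grid_space P" unfolding up_def by (intro G_intros u Nu)
  define NQp where "NQp = N_Q P (Qp, up, sp)"
  define Nup where "Nup = N_u P (Qp, up, sp)"
  have NQp: "NQp \<in> grid_space_S P" and Nup: "Nup \<in> grid_space P"
    using N_Q_in_grid_space_S[OF Qp up] N_u_in_grid_space[OF Qp up] by (auto simp: NQp_def Nup_def)
  define Q' where "Q' = (\<lambda>x. fun_L P tau (\<lambda>z. exp (- z)) Q x + tau *\<^sub>R fun_L P tau phi1 NQ x
                 + tau *\<^sub>R fun_L P tau phi2 (\<lambda>y. NQp y - NQ y) x)"
  define u' where "u' = (\<lambda>x. fun_D P tau (\<lambda>z. exp (- z)) u x + tau * fun_D P tau phi1 Nu x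
                 + tau * fun_D P tau phi2 (\<lambda>y. Nup y - Nu y) x)"
  have dNQ: "(\<lambda>y. NQp y - NQ y) \<in> grid_space_S P" by (intro S_intros NQp NQ)
  have dNu: "(\<lambda>y. Nup y - Nu y) \<in> grid_space P" by (intro G_intros Nup Nu)
  have Q': "Q' \<in> grid_space_S P" unfolding Q'_def by (intro S_intros Q NQ dNQ)
  have u': "u' \<in> grid_space P" unfolding u'_def by (intro G_intros u Nu dNu)
  define s' where "s' = s - 1/2 * grid_inner P (\<lambda>x. NQ x + NQp x) (\<lambda>x. Q' x - Q x)
                - 1/2 * grid_inner P (\<lambda>x. Nu x + Nup x) (\<lambda>x. u' x - u x)
                - 1/4 * grid_inner P (L_op P (\<lambda>x. Q' x - Qp x)) (\<lambda>x. Q' x - Qp x)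
                - 1/4 * grid_inner P (D_op P (\<lambda>x. u' x - up x)) (\<lambda>x. u' x - up x)"
  have step: "gsav_etd2_step P tau X = (Q', u', s')"
    unfolding gsav_etd2_step_def pred
    unfolding NQ_def Nu_def NQp_def Nup_def Q'_def u'_def s'_def X by (simp add: Let_def)
  show "admissible P (gsav_etd2_step P tau X)"
    using Q' u' by (simp add: step admissible_def)
  \<comment> \<open>Strictness comes from \<open>p_kappa P > 0\<close>: the gradient term vanishes
    on constants.\<close>
  have Lpos: "0 < grid_inner P (\<lambda>x. tau *\<^sub>R L_op P U x) U"
    if "U \<in> grid_space_S P" "U \<noteq> (\<lambda>x. 0)" for U :: "('d, real^'d^'d) gridfun"
  proof -
    have U: "U \<in> grid_space P" using that by (simp add: grid_space_S_def)
    show ?thesis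
      using grid_norm_sq_pos[OF U L J that(2)] par tau
      by (simp add: grid_inner_scaleR_left L_op_energy[OF U L J] add_nonneg_pos)
  qed
  have Dpos: "0 < grid_inner P (\<lambda>x. tau * D_op P U x) U"
    if "U \<in> grid_space P" "U \<noteq> (\<lambda>x. 0)" for U :: "('d, real) gridfun"
    using grid_norm_sq_pos[OF that(1) L J that(2)] par tau
      grid_inner_scaleR_left[of P tau "D_op P U" U]
    by (simp add: D_op_energy[OF that(1) L J] add_nonneg_pos)
  \<comment> \<open>With \<open>N\<close> the old nonlinear term and \<open>Y\<close> the predictor
    difference, \<open>2 *\<^sub>R N + Y\<close> is the sum of old and predicted terms that occurs
    in the update of \<open>s\<close>.\<close>
  have two: "2 *\<^sub>R NQ x + (NQp x - NQ x) = NQ x + NQp x" "2 *\<^sub>R Nu x + (Nup x - Nu x) = Nu x + Nup x" for x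
    by (simp_all add: scaleR_2)
  have "1/2 * (tau * grid_inner P (L_op P Q') Q') - 1/2 * (tau * grid_inner P (L_op P Q) Q)
     - 1/2 * (tau * grid_inner P (\<lambda>x. NQ x + NQp x) (\<lambda>x. Q' x - Q x))
     - 1/4 * (tau * grid_inner P (L_op P (\<lambda>x. Q' x - Qp x)) (\<lambda>x. Q' x - Qp x)) \<le> 0"
    using L.etd2_inequality[unfolded S, OF Q NQ dNQ Lpos, of Qp tau Q']
    unfolding Qp_def Q'_def fun_L_def grid_inner_scaleR_left two by blast
  \<comment> \<open>The interpreted operator is tau times \<open>L_op P\<close>, so every term
    carries a factor tau, which is divided out.\<close>
  then have "tau * (1/2 * grid_inner P (L_op P Q') Q' - 1/2 * grid_inner P (L_op P Q) Q
     - 1/2 * grid_inner P (\<lambda>x. NQ x + NQp x) (\<lambda>x. Q' x - Q x)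
     - 1/4 * grid_inner P (L_op P (\<lambda>x. Q' x - Qp x)) (\<lambda>x. Q' x - Qp x)) \<le> 0"
    by (simp add: algebra_simps)
  then have ineq_Q: "1/2 * grid_inner P (L_op P Q') Q' - 1/2 * grid_inner P (L_op P Q) Q
     - 1/2 * grid_inner P (\<lambda>x. NQ x + NQp x) (\<lambda>x. Q' x - Q x)
     - 1/4 * grid_inner P (L_op P (\<lambda>x. Q' x - Qp x)) (\<lambda>x. Q' x - Qp x) \<le> 0"
    using tau by (simp add: mult_le_0_iff)
  have "1/2 * (tau * grid_inner P (D_op P u') u') - 1/2 * (tau * grid_inner P (D_op P u) u)
     - 1/2 * (tau * grid_inner P (\<lambda>x. Nu x + Nup x) (\<lambda>x. u' x - u x))
     - 1/4 * (tau * grid_inner P (D_op P (\<lambda>x. u' x - up x)) (\<lambda>x. u' x - up x)) \<le> 0"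
    using D.etd2_inequality[unfolded G, OF u Nu dNu Dpos, of up tau u']
    unfolding up_def u'_def fun_D_def two
    unfolding real_scaleR_def[symmetric] grid_inner_scaleR_left by blast
  then have "tau * (1/2 * grid_inner P (D_op P u') u' - 1/2 * grid_inner P (D_op P u) u
     - 1/2 * grid_inner P (\<lambda>x. Nu x + Nup x) (\<lambda>x. u' x - u x)
     - 1/4 * grid_inner P (D_op P (\<lambda>x. u' x - up x)) (\<lambda>x. u' x - up x)) \<le> 0"
    by (simp add: algebra_simps)
  then have ineq_u: "1/2 * grid_inner P (D_op P u') u' - 1/2 * grid_inner P (D_op P u) u
     - 1/2 * grid_inner P (\<lambda>x. Nu x + Nup x) (\<lambda>x. u' x - u x)
     - 1/4 * grid_inner P (D_op P (\<lambda>x. u' x - up x)) (\<lambda>x. u' x - up x) \<le> 0"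
    using tau by (simp add: mult_le_0_iff)
  have "Q \<in> grid_space P" "Q' \<in> grid_space P" using Q Q' by (auto simp: grid_space_S_def)
  \<comment> \<open>Inserting \<open>s'\<close> into \<open>energy_eq\<close>, the energy difference
    is exactly the sum of the left-hand sides of \<open>ineq_Q\<close> and
    \<open>ineq_u\<close>.\<close>
  then show "energy P (gsav_etd2_step P tau X) \<le> energy P X"
    unfolding step unfolding X using ineq_Q ineq_u u u'
    by (simp add: energy_eq L J s'_def)
qed

theorem theorem3p3:
  fixes P :: gsav_params
    and tau :: real
    and Q0 :: "real^'d::finite \<Rightarrow> real^'d^'d"
    and u0 :: "real^'d \<Rightarrow> real"
  assumes grid: "p_L P > 0" "p_J P > 0"
    and params: "p_K P > 0" "p_beta P \<ge> 0" "p_gamma P > 0" "p_c P > 0" "p_B0 P > 0" "p_q P \<ge> 0"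
    and kappa: "p_kappa P > 0"
    and dim: "CARD('d) = 3 \<and> p_alpha P < (p_beta P)^2 / (27 * p_gamma P)
              \<or> CARD('d) = 2 \<and> p_alpha P < 0"
    and zeta: "p_zeta P C1_differentiable_on UNIV"
              "\<And>r. p_zeta P r > 0" "\<And>r. deriv (p_zeta P) r \<ge> 0"
    and Q0: "\<And>x. Q0 x \<in> sym_traceless" "\<And>x k. Q0 (x + axis k (p_L P)) = Q0 x"
    and u0: "\<And>x k. u0 (x + axis k (p_L P)) = u0 x"
    and tau: "tau > 0"
  shows "\<forall>n. energy P (gsav_etd2 P tau Q0 u0 (Suc n)) \<le> energy P (gsav_etd2 P tau Q0 u0 n)"
proof -
  note step = gsav_etd2_step_dissipation[OF grid params(1,5) kappa tau]
  have "admissible P (gsav_etd2 P tau Q0 u0 n)" for n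
  proof (induction n)
    case 0
    have "grid_restrict P Q0 \<in> grid_space P" "grid_restrict P u0 \<in> grid_space P"
      using grid_restrict_in_grid_space[OF grid(2)] Q0(2) u0 by blast+
    then show ?case using Q0(1) by (simp add: admissible_def grid_space_S_def grid_restrict_def)
  next
    case (Suc n)
    then show ?case by (simp add: step(1))
  qed
  then show ?thesis by (simp add: step(2))
qed

end
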